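(* Let $(Z_n)_{n\ge 0}$ be a branching process in random environment with linear fractional offspring distributions, started from $Z_0=1$. Assume that $$0<\mathbb{E}\big[Xe^{-X}\big]<\infty$$ and that $\mathbf{E}\big[\log(1-Q(0))\big]>-\infty$. Then there is a probability distribution $r=(r_z)_{z\in\mathbb{N}}$ on $\mathbb{N}$ such that for all $t\in(0,1)$ and all $z\in\mathbb{N}$ $$\lim_{n\to\infty}\mathbb{P}(Z_{\lfloor nt\rfloor}=z\mid Z_n=1)=r_z .$$ Moreover, $r_z$ does not depend on $t$ and is given by $$r_z=z\,\mathbf{E}\big[\mathbb{P}(Z_\infty>0\mid\Pi)^2\,\mathbb{P}(Z_\infty=0\mid\Pi)^{z-1}\big].$$
   Context: Let $\Delta$ be the space of probability distributions on $\mathbb{N}_0=\{0,1,2,\dots\}$, and $\mathbb{N}=\{1,2,\dots\}$; for $q\in\Delta$ write $q(y):=q(\{y\})$ and $m(q):=\sum_{y\ge 0} y\,q(y)$. Let $Q$ be a $\Delta$-valued random variable. Throughout, $Q$ is a.s. linear fractional: $Q(0)=a$ and $Q(k)=\frac{(1-a)(1-p)}{p}p^k$ for $k\ge 1$, where $a\in[0,1)$ and $p\in(0,1)$ are random parameters. A random environment is an i.i.d. sequence $\Pi=(Q_1,Q_2,\dots)$ of copies of $Q$. The branching process $(Z_n)_{n\ge0}$ in the environment $\Pi$: $Z_0$ is independent of $\Pi$ and, given $\Pi$, $(Z_n)$ is a Markov chain with $\mathcal{L}(Z_n\mid Z_{n-1}=z,\Pi=(q_1,q_2,\dots))=q_n^{*z}$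 ($z$-fold convolution). $\mathbb{P}$ denotes the law with $Z_0=1$. $\{Z_\infty>0\}$ denotes the event $\{Z_n>0\ \forall n\in\mathbb{N}\}$ and $\{Z_\infty=0\}$ its complement; the quenched probabilities $\mathbb{P}(Z_\infty>0\mid\Pi)$, $\mathbb{P}(Z_\infty=0\mid\Pi)$ are functions of the environment $\Pi$ (for $Z_0=1$), and $0^0=1$. Let $X:=\log m(Q)$. The process is supercritical, i.e. $\mathbb{E}[X]>0$. Change of measure: with $\gamma:=\mathbb{E}[e^{-X}]$ (finite under the hypotheses), $\mathbf{P}$ (with expectation $\mathbf{E}$) is the measure determined by $\mathbf{E}[\phi(Q)]:=\gamma^{-1}\mathbb{E}[e^{-X}\phi(Q)]$ for bounded measurable $\phi:\Delta\to\mathbb{R}$; under $\mathbf{P}$ the environment $Q_1,Q_2,\dots$ is i.i.d. with this tilted law, and the conditional law of $(Z_n)$ given $\Pi$ is unchanged. *)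

theory Defs
  imports "HOL-Probability.Probability"
begin

text \<open>
  The space of probability distributions on the nonnegative integers is the type \<^typ>\<open>nat pmf\<close>,
  with the \<open>\<sigma>\<close>-algebra generated by the evaluations \<open>q \<mapsto> q(y)\<close>; it is the Borel
  \<open>\<sigma>\<close>-algebra both of weak convergence and of total variation.
\<close>

definition distr_space :: "nat pmf measure" where
  "distr_space = vimage_algebra UNIV pmf (PiM UNIV (\<lambda>_. borel))"

abbreviation env_space :: "(nat \<Rightarrow> nat pmf) measure" where
  "env_space \<equiv> PiM UNIV (\<lambda>_. distr_space)"

primrec conv_power :: "nat pmf \<Rightarrow> nat \<Rightarrow> nat pmf" where
  "conv_power q 0 = return_pmf 0"
| "conv_power q (Suc z) = map_pmf (\<lambda>(x, y). x + y) (pair_pmf q (conv_power q z))"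

text \<open>
  The mean is used only for distributions of finite mean (a non-summable series has an
  unspecified real value).
\<close>

definition offspring_mean :: "nat pmf \<Rightarrow> real" where
  "offspring_mean q = (\<Sum>y. real y * pmf q y)"

definition log_mean :: "nat pmf \<Rightarrow> real" where
  "log_mean q = ln (offspring_mean q)"

definition linear_fractional :: "nat pmf \<Rightarrow> bool" where
  "linear_fractional q \<longleftrightarrow>
     (\<exists>a p. 0 \<le> a \<and> a < 1 \<and> 0 < p \<and> p < 1 \<and> pmf q 0 = a \<and>
        (\<forall>k\<ge>1. pmf q k = (1 - a) * (1 - p) / p * p ^ k))"

text \<open>
  Environments are indexed from \<open>0\<close>: \<open>Q n\<close> is the offspring distribution governing the step from
  \<open>Z n\<close> to \<open>Z (Suc n)\<close>, so that \<open>Q 0, Q 1, \<dots>\<close> are the usual \<open>Q\<^sub>1, Q\<^sub>2, \<dots>\<close>, and \<open>Q 0\<close> also serves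
  as the generic copy \<open>Q\<close>. The chain property conditions on the whole environment (future included)
  together with \<open>Z 0, \<dots>, Z n\<close>.
\<close>

locale branching_process_re = prob_space M
  for M :: "'w measure" +
  fixes Q :: "nat \<Rightarrow> 'w \<Rightarrow> nat pmf" and Z :: "nat \<Rightarrow> 'w \<Rightarrow> nat"
  assumes Q_measurable: "\<And>n. Q n \<in> measurable M distr_space"
    and Z_measurable: "\<And>n. Z n \<in> measurable M (count_space UNIV)"
    and Q_indep: "indep_vars (\<lambda>_. distr_space) Q UNIV"
    and Q_ident: "\<And>n. distr M distr_space (Q n) = distr M distr_space (Q 0)"
    and Z0_indep: "indep_set (sets (vimage_algebra (space M) (Z 0) (count_space UNIV)))
                             (sets (vimage_algebra (space M) (\<lambda>\<omega> n. Q n \<omega>) env_space))"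
    and Z_chain: "\<And>n j. AE \<omega> in M.
        real_cond_exp M
          (vimage_algebra (space M) (\<lambda>\<omega>. (\<lambda>k. Q k \<omega>, \<lambda>k\<in>{..n}. Z k \<omega>))
             (env_space \<Otimes>\<^sub>M PiM {..n} (\<lambda>_. count_space UNIV)))
          (indicator {\<omega> \<in> space M. Z (Suc n) \<omega> = j}) \<omega>
        = pmf (conv_power (Q n \<omega>) (Z n \<omega>)) j"

text \<open>
  The quenched law: for a fixed environment \<open>\<pi>\<close> the law on path space, given by the
  Ionescu-Tulcea theorem, of the Markov chain started in \<open>z0\<close> whose step from time \<open>n\<close> to
  time \<open>n + 1\<close> has transition probabilities \<open>z \<mapsto> (\<pi> n)\<^sup>*\<^sup>z\<close>.
\<close>

primrec quenched_kernel :: "(nat \<Rightarrow> nat pmf) \<Rightarrow> nat \<Rightarrow> nat \<Rightarrow> (nat \<Rightarrow> nat) \<Rightarrow> nat measure" where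
  "quenched_kernel \<pi> z0 0 x = measure_pmf (return_pmf z0)"
| "quenched_kernel \<pi> z0 (Suc n) x = measure_pmf (conv_power (\<pi> n) (x n))"

definition quenched_law :: "(nat \<Rightarrow> nat pmf) \<Rightarrow> nat \<Rightarrow> (nat \<Rightarrow> nat) measure" where
  "quenched_law \<pi> z0 = projective_family.lim UNIV
     (Ionescu_Tulcea.CI (quenched_kernel \<pi> z0) (\<lambda>_. count_space UNIV)) (\<lambda>_. count_space UNIV)"

definition survival_prob :: "(nat \<Rightarrow> nat pmf) \<Rightarrow> real" where
  "survival_prob \<pi> = \<P>(x in quenched_law \<pi> 1. \<forall>n\<ge>1. x n > 0)"

definition extinction_prob :: "(nat \<Rightarrow> nat pmf) \<Rightarrow> real" where
  "extinction_prob \<pi> = \<P>(x in quenched_law \<pi> 1. \<not> (\<forall>n\<ge>1. x n > 0))"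

definition tilted_law :: "nat pmf measure \<Rightarrow> nat pmf measure" where
  "tilted_law \<mu> = density \<mu>
     (\<lambda>q. ennreal (exp (- log_mean q) / (\<integral>q'. exp (- log_mean q') \<partial>\<mu>)))"

text \<open>
  The remaining lemmas confirm that \<^const>\<open>quenched_law\<close> is a probability measure with the
  finite-dimensional distributions of the chain.
\<close>

lemma Ionescu_Tulcea_quenched: "Ionescu_Tulcea (quenched_kernel \<pi> z0) (\<lambda>_. count_space UNIV)"
proof (rule Ionescu_Tulcea.intro)
  fix i
  show "quenched_kernel \<pi> z0 i \<in> measurable (PiM {0..<i} (\<lambda>_. count_space UNIV))
          (subprob_algebra (count_space UNIV))"
  proof (cases i)
    case 0
    have "quenched_kernel \<pi> z0 0 = (\<lambda>_. measure_pmf (return_pmf z0))"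
      by (rule ext) simp
    then show ?thesis
      using 0 by (simp add: measure_pmf_in_subprob_algebra)
  next
    case (Suc k)
    have eq: "quenched_kernel \<pi> z0 i = (\<lambda>x. measure_pmf (conv_power (\<pi> k) (x k)))"
      by (rule ext) (simp add: Suc)
    have comp: "(\<lambda>x. x k) \<in> measurable (PiM {0..<i} (\<lambda>_. count_space UNIV)) (count_space (UNIV :: nat set))"
      by (rule measurable_component_singleton) (simp add: Suc)
    show ?thesis
      unfolding eq
      by (rule measurable_compose[OF comp measurable_measure_pmf])
  qed
next
  fix i and x :: "nat \<Rightarrow> nat"
  assume "x \<in> space (PiM {0..<i} (\<lambda>_. count_space UNIV))"
  show "prob_space (quenched_kernel \<pi> z0 i x)"
    by (cases i) (auto intro: measure_pmf.prob_space_axioms)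
qed

lemma sets_quenched_law: "sets (quenched_law \<pi> z0) = sets (PiM UNIV (\<lambda>_. count_space UNIV))"
proof -
  interpret Ionescu_Tulcea "quenched_kernel \<pi> z0" "\<lambda>_. count_space UNIV"
    by (rule Ionescu_Tulcea_quenched)
  show ?thesis
    unfolding quenched_law_def by simp
qed

lemma space_quenched_law: "space (quenched_law \<pi> z0) = UNIV"
  using sets_eq_imp_space_eq[OF sets_quenched_law] by (simp add: space_PiM)

lemma quenched_law_fdd:
  "emeasure (quenched_law \<pi> z0) {x. \<forall>i\<le>n. x i = y i} =
     ennreal (if y 0 = z0 then \<Prod>i<n. pmf (conv_power (\<pi> i) (y i)) (y (Suc i)) else 0)"
proof -
  interpret Ionescu_Tulcea "quenched_kernel \<pi> z0" "\<lambda>_. count_space UNIV"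
    by (rule Ionescu_Tulcea_quenched)
  have cyl: "{x. \<forall>i\<le>n. x i = y i} = PF.emb UNIV {0..<Suc n} (PiE {0..<Suc n} (\<lambda>i. {y i}))"
    by (auto simp: prod_emb_def space_PiM PiE_iff less_Suc_eq_le)
  have meas: "PiE {0..<m} (\<lambda>i. {y i}) \<in> sets (PiM {0..<m} (\<lambda>_. count_space UNIV))" for m
    by (rule sets_PiM_I_finite) auto
  have eC: "emeasure (C 0 (Suc n) (\<lambda>_. undefined)) (PiE {0..<Suc n} (\<lambda>i. {y i})) =
     ennreal (if y 0 = z0 then \<Prod>i<n. pmf (conv_power (\<pi> i) (y i)) (y (Suc i)) else 0)" for n
  proof -
    define w where "w m = (\<lambda>i. if i < m then y i else undefined)" for m :: nat
    have wset: "PiE {0..<m} (\<lambda>i. {y i}) = {w m}" for m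
      by (auto simp: w_def PiE_iff extensional_def fun_eq_iff split: if_splits)
    have wspace: "w m \<in> space (PiM {0..<m} (\<lambda>_. count_space UNIV))" for m
      by (auto simp: w_def space_PiM PiE_iff extensional_def)
    have step: "emeasure (C 0 (Suc m) (\<lambda>_. undefined)) {w (Suc m)} =
       emeasure (C 0 m (\<lambda>_. undefined)) {w m} * emeasure (quenched_kernel \<pi> z0 m (w m)) {y m}" for m
    proof -
      have spC: "space (C 0 m (\<lambda>_. undefined)) = space (PiM {0..<m} (\<lambda>_. count_space UNIV))"
        using space_C[of "\<lambda>_. undefined" 0 m] by simp
      have sC: "sets (C 0 m (\<lambda>_. undefined)) = sets (PiM {0..<m} (\<lambda>_. count_space UNIV))"
        using sets_C[of "\<lambda>_. undefined" 0 m] by simp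
      have "emeasure (C 0 (Suc m) (\<lambda>_. undefined)) {w (Suc m)} =
        (\<integral>\<^sup>+x. emeasure (eP m x) {w (Suc m)} \<partial>C 0 m (\<lambda>_. undefined))"
        unfolding C.simps add_0
        by (rule emeasure_bind[where N = "PiM {0..<Suc m} (\<lambda>_. count_space UNIV)"])
          (use meas[of "Suc m"] wspace[of m] in
            \<open>auto simp: wset spC measurable_eP measurable_cong_sets[OF sC refl]\<close>)
      also have "\<dots> = (\<integral>\<^sup>+x. emeasure (quenched_kernel \<pi> z0 m (w m)) {y m} * indicator {w m} x
          \<partial>C 0 m (\<lambda>_. undefined))"
      proof (rule nn_integral_cong)
        fix x assume "x \<in> space (C 0 m (\<lambda>_. undefined))"
        then have x: "x \<in> space (PiM {0..<m} (\<lambda>_. count_space UNIV))" by (simp add: spC)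
        then have ext: "x \<in> extensional {0..<m}" by (simp add: space_PiM PiE_iff)
        have "emeasure (eP m x) {w (Suc m)} =
          emeasure (quenched_kernel \<pi> z0 m x) ((\<lambda>k. x(m := k)) -` {w (Suc m)} \<inter> UNIV)"
          using emeasure_eP[OF x, of "{w (Suc m)}"] meas[of "Suc m"] by (simp add: wset)
        also have "(\<lambda>k. x(m := k)) -` {w (Suc m)} \<inter> UNIV = (if x = w m then {y m} else {})"
        proof -
          have "x(m := k) = w (Suc m) \<longleftrightarrow> x = w m \<and> k = y m" for k
          proof
            assume eq: "x(m := k) = w (Suc m)"
            have "x i = w m i" for i
              using fun_cong[OF eq, of i] ext
              by (cases "i < m") (auto simp: w_def extensional_def)
            moreover have "k = y m"
              using fun_cong[OF eq, of m] by (simp add: w_def)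
            ultimately show "x = w m \<and> k = y m" by auto
          qed (auto simp: w_def fun_eq_iff)
          then show ?thesis by auto
        qed
        finally show "emeasure (eP m x) {w (Suc m)} =
          emeasure (quenched_kernel \<pi> z0 m (w m)) {y m} * indicator {w m} x"
          by (auto split: split_indicator)
      qed
      also have "\<dots> = emeasure (quenched_kernel \<pi> z0 m (w m)) {y m} *
          emeasure (C 0 m (\<lambda>_. undefined)) {w m}"
        by (rule nn_integral_cmult_indicator) (use meas[of m] in \<open>simp add: wset sC\<close>)
      finally show ?thesis by (simp add: mult.commute)
    qed
    have C0: "emeasure (C 0 0 (\<lambda>_. undefined)) {w 0} = 1"
    proof -
      have "w 0 = (\<lambda>_. undefined)" by (simp add: w_def)
      then show ?thesis using meas[of 0] by (simp add: wset emeasure_return)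
    qed
    show ?thesis
      unfolding wset
    proof (induction n)
      case 0
      show ?case
        unfolding step C0 by (simp add: emeasure_pmf_single)
    next
      case (Suc n)
      show ?case
        unfolding step[of "Suc n"] Suc.IH
        by (simp add: emeasure_pmf_single w_def ennreal_mult prod_nonneg)
    qed
  qed
  have "emeasure (quenched_law \<pi> z0) {x. \<forall>i\<le>n. x i = y i} =
      emeasure (CI {0..<Suc n}) (PiE {0..<Suc n} (\<lambda>i. {y i}))"
    unfolding quenched_law_def cyl by (rule lim) (use meas in auto)
  also have "\<dots> = emeasure (C 0 (Suc n) (\<lambda>_. undefined)) (PiE {0..<Suc n} (\<lambda>i. {y i}))"
    by (subst emeasure_CI[of _ "Suc n"]) (use meas[of "Suc n"] sets.sets_into_space[OF meas] in \<open>auto simp: prod_emb_id\<close>)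
  finally show ?thesis
    by (simp only: eC)
qed

lemma prob_space_quenched_law: "prob_space (quenched_law \<pi> z0)"
proof -
  interpret Ionescu_Tulcea "quenched_kernel \<pi> z0" "\<lambda>_. count_space UNIV"
    by (rule Ionescu_Tulcea_quenched)
  show ?thesis
  proof
    have "space (quenched_law \<pi> z0) = PF.emb UNIV {} (space (PiM {} (\<lambda>_. count_space UNIV)))"
      by (auto simp: space_quenched_law prod_emb_def space_PiM)
    then have "emeasure (quenched_law \<pi> z0) (space (quenched_law \<pi> z0)) =
        emeasure (CI {}) (space (PiM {} (\<lambda>_. count_space UNIV)))"
      unfolding quenched_law_def using lim[of "{}" "space (PiM {} (\<lambda>_. count_space UNIV))"] by simp
    also have "\<dots> = 1"
      using prob_space.emeasure_space_1[OF PF.prob_space_P[of "{}"]] PF.space_P[of "{}"] by simp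
    finally show "emeasure (quenched_law \<pi> z0) (space (quenched_law \<pi> z0)) = 1" .
  qed
qed

end

theory Submission
  imports Defs
begin

text \<open>
  Write \<open>S n\<close> for the sum of the first \<open>n\<close> log-means of the environment \<open>\<pi>\<close>, and \<open>P n\<close> for the quenched
  probability of survival up to time \<open>n\<close>. If \<open>f\<close> is the generating function of a linear fractional
  law, \<open>1 / (1 - f s)\<close> is an affine function of \<open>1 / (1 - s)\<close>. Composition preserves this property,
  so the quenched law of \<open>Z n\<close> is again linear fractional, with the explicit masses
  \<open>exp (- S n) * (P n)\<^sup>2 * (1 - exp (- S n) * P n) ^ j\<close> at \<open>j + 1\<close>
  (\<open>lin_frac_gf_gen_law\<close>, \<open>pmf_gen_law_linear_fractional\<close>).

  The factor \<open>exp (- S n)\<close> is, up to \<open>\<gamma> ^ n\<close>, the density of the tilted environment with respect to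
  the original one on the first \<open>n\<close> coordinates. Hence annealed probabilities are tilted
  expectations of bounded quantities: started from one individual,
  \<open>P(Z n = j + 1) = \<gamma> ^ n * E[(P n)\<^sup>2 * (1 - exp (- S n) * P n) ^ j]\<close>, and by the branching property,
  started from \<open>j + 1\<close> individuals,
  \<open>P(Z n = 1) = (j + 1) * \<gamma> ^ n * E[(P n)\<^sup>2 * (1 - P n) ^ j]\<close>
  (\<open>annealed_mass_from_one\<close>, \<open>annealed_mass_to_one\<close>).

  Under the tilted law the walk \<open>S\<close> has positive drift, since its mean step is
  \<open>E[X * exp (- X)] / \<gamma>\<close>. Therefore \<open>exp (- S n)\<close> tends to \<open>0\<close> almost surely, and together with the
  integrability of \<open>ln (1 - Q 0 0)\<close> the survival probability \<open>s\<close>, the limit of \<open>P n\<close>, is almost surely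
  positive (\<open>AE_env_drift\<close>). Both follow from a linear lower bound on \<open>S n + ln (1 - Q n 0)\<close>, where
  \<open>Q n 0\<close> is the mass at \<open>0\<close> of the \<open>n\<close>-th offspring distribution; a maximal inequality for penalised
  partial sums provides it (\<open>penalised_walk_bounded_below\<close>). By dominated convergence the two tilted
  expectations converge to \<open>E[s\<^sup>2]\<close> and to \<open>E[s\<^sup>2 * (1 - s) ^ j]\<close>.

  Finally, the environment before time \<open>m\<close> is independent of the environment after it, so
  \<open>P(Z m = j + 1, Z n = 1)\<close> is the product of an annealed mass from one over \<open>m\<close> steps and an annealed
  mass to one over \<open>n - m\<close> steps (\<open>annealed_two_point\<close>). On division by \<open>P(Z n = 1)\<close> all powers of
  \<open>\<gamma>\<close> and the factor \<open>E[s\<^sup>2]\<close> cancel, and \<open>(j + 1) * E[s\<^sup>2 * (1 - s) ^ j]\<close> remains whenever both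
  \<open>m\<close> and \<open>n - m\<close> tend to infinity; the fraction \<open>t\<close> enters in no other way. These numbers sum to
  \<open>1\<close>, because \<open>\<Sum>j. (j + 1) * (1 - s) ^ j = 1 / s\<^sup>2\<close> when \<open>s > 0\<close>.
\<close>

section \<open>Probability generating functions\<close>

definition pmf_gf :: "nat pmf \<Rightarrow> real \<Rightarrow> real" where
  "pmf_gf q s = measure_pmf.expectation q (\<lambda>k. s ^ k)"

lemma expectation_bind_bounded:
  fixes f :: "'a \<Rightarrow> real"
  assumes "\<And>x. \<bar>f x\<bar> \<le> B"
  shows "measure_pmf.expectation (bind_pmf p K) f =
    measure_pmf.expectation p (\<lambda>x. measure_pmf.expectation (K x) f)"
  unfolding measure_pmf_bind
  by (rule integral_bind[where K = "count_space UNIV" and B = B and B' = 1])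
     (use assms in \<open>auto simp: measure_pmf.emeasure_space_1 measure_pmf_in_subprob_algebra\<close>)

lemma integrable_power_pmf: "\<bar>s\<bar> \<le> 1 \<Longrightarrow> integrable (measure_pmf q) (\<lambda>k. s ^ k :: real)"
  by (rule measure_pmf.integrable_const_bound[of _ 1]) (auto simp: power_abs power_le_one)

lemma pmf_gf_sums:
  assumes "\<bar>s\<bar> \<le> 1"
  shows "(\<lambda>k. pmf q k * s ^ k) sums pmf_gf q s"
proof -
  have "integrable (count_space UNIV) (\<lambda>k. pmf q k * s ^ k)"
    using integrable_power_pmf[OF assms, of q]
    unfolding measure_pmf_eq_density by (subst (asm) integrable_density) auto
  from sums_integral_count_space_nat[OF this] show ?thesis
    unfolding pmf_gf_def measure_pmf_eq_density by (subst integral_density) auto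
qed

lemma abs_pmf_gf_le: "\<bar>s\<bar> \<le> 1 \<Longrightarrow> \<bar>pmf_gf q s\<bar> \<le> 1"
proof -
  assume s: "\<bar>s\<bar> \<le> 1"
  have "norm (pmf_gf q s) \<le> measure_pmf.expectation q (\<lambda>k. norm (s ^ k))"
    unfolding pmf_gf_def by (rule integral_norm_bound)
  also have "\<dots> \<le> measure_pmf.expectation q (\<lambda>k. 1)"
    using s integrable_power_pmf[of "\<bar>s\<bar>" q]
    by (intro integral_mono) (auto simp: power_abs power_le_one)
  finally show ?thesis by simp
qed

lemma abs_pmf_gf_le_gf_abs: "\<bar>pmf_gf q s\<bar> \<le> pmf_gf q \<bar>s\<bar>"
  using integral_norm_bound[of q "\<lambda>k. s ^ k"] by (simp add: pmf_gf_def power_abs)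

text \<open>
  If all coefficients before the \<open>n\<close>-th vanish, divide the series by \<open>s ^ n\<close> and let \<open>s\<close> tend to \<open>0\<close>.
\<close>

lemma power_series_coeff_unique:
  fixes c :: "nat \<Rightarrow> real"
  assumes "\<And>s. \<bar>s\<bar> < 1 \<Longrightarrow> (\<lambda>k. c k * s ^ k) sums 0"
  shows "c n = 0"
proof (induction n rule: less_induct)
  case (less n)
  have "((\<lambda>_. 0) \<longlongrightarrow> c (0 + n)) (at (0::real))"
  proof (rule powser_limit_0_strong[of 1 "\<lambda>k. c (k + n)"])
    fix x :: real assume x: "x \<noteq> 0" "norm x < 1"
    have "(\<lambda>k. c (k + n) * x ^ (k + n)) sums 0"
      using assms[of x] x less by (subst sums_iff_shift) auto
    from sums_mult[OF this, of "inverse (x ^ n)"] show "(\<lambda>k. c (k + n) * x ^ k) sums 0"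
      using x by (simp add: power_add field_simps)
  qed simp
  then show ?case
    by (simp add: tendsto_const_iff)
qed

text \<open>
  This is how masses are read off below: any power series for the generating function on the
  open unit interval has the masses as its coefficients.
\<close>

lemma pmf_eq_power_series_coeff:
  assumes "\<And>s. \<bar>s\<bar> < 1 \<Longrightarrow> (\<lambda>k. c k * s ^ k) sums pmf_gf q s"
  shows "pmf q k = c k"
proof -
  have "pmf q k - c k = 0"
  proof (rule power_series_coeff_unique[of "\<lambda>k. pmf q k - c k"])
    fix s :: real assume "\<bar>s\<bar> < 1"
    then show "(\<lambda>k. (pmf q k - c k) * s ^ k) sums 0"
      using sums_diff[OF pmf_gf_sums[of s q] assms[of s]] by (simp add: left_diff_distrib)
  qed
  then show ?thesis by simp
qed

lemma pmf_eqI_gf: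
  assumes "\<And>s. \<bar>s\<bar> < 1 \<Longrightarrow> pmf_gf p s = pmf_gf q s"
  shows "p = q"
proof (rule pmf_eqI, rule pmf_eq_power_series_coeff)
  fix s :: real assume "\<bar>s\<bar> < 1"
  then show "(\<lambda>k. pmf q k * s ^ k) sums pmf_gf p s"
    using pmf_gf_sums[of s q] assms[of s] by simp
qed

lemma pmf_gf_return [simp]: "pmf_gf (return_pmf z) s = s ^ z"
  by (simp add: pmf_gf_def)

lemma pmf_gf_conv_power:
  assumes "\<bar>s\<bar> \<le> 1"
  shows "pmf_gf (conv_power q z) s = pmf_gf q s ^ z"
proof (induction z)
  case (Suc z)
  have "pmf_gf (conv_power q (Suc z)) s =
      measure_pmf.expectation (pair_pmf q (conv_power q z)) (\<lambda>(x, y). s ^ x * s ^ y)"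
    by (simp add: pmf_gf_def case_prod_unfold power_add)
  also have "\<dots> = measure_pmf.expectation q (\<lambda>x. s ^ x * pmf_gf (conv_power q z) s)"
    unfolding pair_pmf_def pmf_gf_def map_pmf_def[symmetric]
    using assms
    by (subst expectation_bind_bounded[where B = 1])
       (auto simp: power_abs abs_mult power_le_one mult_le_one)
  also have "\<dots> = pmf_gf q s ^ Suc z"
    using Suc by (simp add: pmf_gf_def)
  finally show ?case .
qed simp

text \<open>
  The quenched law of the generation size at time \<open>n\<close> with \<open>z\<close> individuals at time \<open>0\<close>, as a mass
  function rather than as a marginal of a measure on path space; the two are identified in
  \<open>quenched_law_marginal\<close>.
\<close>

primrec gen_law :: "(nat \<Rightarrow> nat pmf) \<Rightarrow> nat \<Rightarrow> nat \<Rightarrow> nat pmf" where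
  "gen_law \<pi> z 0 = return_pmf z"
| "gen_law \<pi> z (Suc n) = bind_pmf (gen_law \<pi> z n) (conv_power (\<pi> n))"

lemma pmf_gf_gen_law_Suc:
  assumes "\<bar>s\<bar> \<le> 1"
  shows "pmf_gf (gen_law \<pi> z (Suc n)) s = pmf_gf (gen_law \<pi> z n) (pmf_gf (\<pi> n) s)"
proof -
  have "pmf_gf (gen_law \<pi> z (Suc n)) s =
      measure_pmf.expectation (gen_law \<pi> z n) (\<lambda>k. pmf_gf (conv_power (\<pi> n) k) s)"
    unfolding pmf_gf_def gen_law.simps using assms
    by (intro expectation_bind_bounded[where B = 1]) (simp add: power_abs power_le_one)
  then show ?thesis
    using assms by (simp add: pmf_gf_conv_power pmf_gf_def[of "gen_law \<pi> z n"])
qed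

text \<open>
  The branching property: the lines of descent of \<open>z\<close> ancestors are independent copies of each
  other. Both sides have the \<open>z\<close>-th power of the same generating function.
\<close>

lemma gen_law_branching: "gen_law \<pi> z n = conv_power (gen_law \<pi> 1 n) z"
proof (rule pmf_eqI_gf)
  fix s :: real assume "\<bar>s\<bar> < 1"
  then have "\<bar>s\<bar> \<le> 1" by simp
  then have "pmf_gf (gen_law \<pi> z n) s = pmf_gf (gen_law \<pi> 1 n) s ^ z"
    by (induction n arbitrary: s) (simp_all add: pmf_gf_gen_law_Suc abs_pmf_gf_le del: gen_law.simps(2))
  then show "pmf_gf (gen_law \<pi> z n) s = pmf_gf (conv_power (gen_law \<pi> 1 n) z) s"
    using \<open>\<bar>s\<bar> \<le> 1\<close> by (simp add: pmf_gf_conv_power)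
qed

lemma pmf_conv_power_Suc:
  "pmf (conv_power q (Suc z)) j = (\<Sum>x\<le>j. pmf q x * pmf (conv_power q z) (j - x))"
proof -
  have "pmf (conv_power q (Suc z)) j =
      measure (pair_pmf q (conv_power q z)) ((\<lambda>(x, y). x + y) -` {j})"
    by (simp add: pmf_map)
  also have "(\<lambda>(x, y). x + y) -` {j} = (\<lambda>x. (x, j - x)) ` {..j}"
    by (auto simp: image_iff)
  also have "measure (pair_pmf q (conv_power q z)) \<dots> = (\<Sum>x\<le>j. pmf q x * pmf (conv_power q z) (j - x))"
    by (subst measure_measure_pmf_finite) (auto simp: sum.reindex inj_on_def pmf_pair)
  finally show ?thesis .
qed

lemma pmf_conv_power_0: "pmf (conv_power q z) 0 = pmf q 0 ^ z"
  by (induction z) (simp_all add: pmf_conv_power_Suc del: conv_power.simps(2))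

lemma pmf_conv_power_1: "pmf (conv_power q z) 1 = real z * pmf q 0 ^ (z - 1) * pmf q 1"
proof (induction z)
  case (Suc z)
  have "pmf (conv_power q (Suc z)) 1 =
      pmf q 0 * pmf (conv_power q z) 1 + pmf q 1 * pmf q 0 ^ z"
    by (simp add: pmf_conv_power_Suc pmf_conv_power_0 del: conv_power.simps(2))
  then show ?case using Suc
    by (cases z) (simp_all add: algebra_simps del: conv_power.simps(2))
qed simp

section \<open>Linear fractional laws\<close>

text \<open>
  Equivalently, \<open>1 / (1 - f s) = A + B / (1 - s)\<close> for the generating function \<open>f\<close>. In these
  coordinates \<open>1 / B\<close> is the mean, \<open>1 / (A + B)\<close> the mass outside \<open>0\<close>, and composition of generating
  functions becomes composition of affine maps.
\<close>

definition lin_frac_gf :: "real \<Rightarrow> real \<Rightarrow> nat pmf \<Rightarrow> bool" where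
  "lin_frac_gf A B q \<longleftrightarrow> 0 \<le> A \<and> 0 < B \<and> (\<forall>s. \<bar>s\<bar> < 1 \<longrightarrow> pmf_gf q s = 1 - (1 - s) / (A * (1 - s) + B))"

text \<open>
  Expand \<open>(1 - s) / (D - A * s)\<close> with \<open>D = A + B\<close> as a geometric series in \<open>A * s / D\<close>.
\<close>

lemma lin_frac_gf_pmf:
  assumes "lin_frac_gf A B q"
  shows "pmf q k = (case k of 0 \<Rightarrow> 1 - 1 / (A + B)
    | Suc j \<Rightarrow> B / (A + B)\<^sup>2 * (A / (A + B)) ^ j)"
proof (rule pmf_eq_power_series_coeff)
  fix s :: real assume s: "\<bar>s\<bar> < 1"
  have AB: "0 \<le> A" "0 < B" and gf: "pmf_gf q s = 1 - (1 - s) / (A * (1 - s) + B)"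
    using assms s by (auto simp: lin_frac_gf_def)
  define D where "D = A + B"
  have D: "0 < D" "A < D" using AB by (auto simp: D_def)
  have "\<bar>A * s\<bar> \<le> A * 1"
    using AB s unfolding abs_mult by (intro mult_mono) auto
  then have As: "0 < D - A * s" using D by auto
  have "\<bar>A / D * s\<bar> < 1"
    using \<open>\<bar>A * s\<bar> \<le> A * 1\<close> D AB by (auto simp: abs_mult field_simps)
  then have "(\<lambda>j. (A / D * s) ^ j) sums (1 / (1 - A / D * s))"
    by (intro geometric_sums) simp
  from sums_mult[OF this, of "B / D\<^sup>2 * s"]
  have "(\<lambda>j. B / D\<^sup>2 * (A / D) ^ j * s ^ Suc j) sums (B / D\<^sup>2 * s / (1 - A / D * s))"
    by (simp add: power_mult_distrib power_divide mult_ac)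
  also have "B / D\<^sup>2 * s / (1 - A / D * s) = (1 - (1 - s) / (A * (1 - s) + B)) - (1 - 1 / D)"
  proof -
    have e: "A * (1 - s) + B = D - A * s" by (simp add: D_def algebra_simps)
    have "1 - A / D * s = (D - A * s) / D" using D by (simp add: field_simps)
    then have "B / D\<^sup>2 * s / (1 - A / D * s) = B * s / (D * (D - A * s))"
      using D As by (simp add: power2_eq_square)
    also have "\<dots> = 1 / D - (1 - s) / (D - A * s)"
    proof -
      have "1 / D - (1 - s) / (D - A * s) = ((D - A * s) - (1 - s) * D) / (D * (D - A * s))"
        using D As by (simp add: diff_frac_eq)
      also have "(D - A * s) - (1 - s) * D = B * s"
        by (simp add: D_def algebra_simps)
      finally show ?thesis by simp
    qed
    finally show ?thesis using e by simp
  qed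
  finally have "(\<lambda>j. case Suc j of 0 \<Rightarrow> 1 - 1 / D | Suc j \<Rightarrow> B / D\<^sup>2 * (A / D) ^ j * s ^ Suc j) sums
      ((1 - (1 - s) / (A * (1 - s) + B)) - (1 - 1 / D))"
    by simp
  from sums_Suc[OF this] have "(\<lambda>k. case k of 0 \<Rightarrow> 1 - 1 / D | Suc j \<Rightarrow> B / D\<^sup>2 * (A / D) ^ j * s ^ Suc j) sums
      (1 - (1 - s) / (A * (1 - s) + B))"
    by simp
  also have "(\<lambda>k. case k of 0 \<Rightarrow> 1 - 1 / D | Suc j \<Rightarrow> B / D\<^sup>2 * (A / D) ^ j * s ^ Suc j) =
    (\<lambda>k. (case k of 0 \<Rightarrow> 1 - 1 / D | Suc j \<Rightarrow> B / D\<^sup>2 * (A / D) ^ j) * s ^ k)"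
    by (auto simp: fun_eq_iff split: nat.split)
  finally show "(\<lambda>k. (case k of 0 \<Rightarrow> 1 - 1 / (A + B) | Suc j \<Rightarrow> B / (A + B)\<^sup>2 * (A / (A + B)) ^ j) * s ^ k)
      sums pmf_gf q s"
    unfolding gf D_def .
qed

lemma linear_fractional_offspring_mean:
  assumes "0 < p" "p < 1" "\<forall>k\<ge>1. pmf q k = (1 - a) * (1 - p) / p * p ^ k"
  shows "offspring_mean q = (1 - a) / (1 - p)"
proof -
  have "(\<lambda>n. (1 - a) * (1 - p) * (real (Suc n) * p ^ n)) sums ((1 - a) * (1 - p) * (1 / (1 - p)\<^sup>2))"
    using geometric_deriv_sums[of p] assms by (intro sums_mult) simp
  also have "(1 - a) * (1 - p) * (1 / (1 - p)\<^sup>2) = (1 - a) / (1 - p)"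
    using assms by (simp add: power2_eq_square)
  also have "(\<lambda>n. (1 - a) * (1 - p) * (real (Suc n) * p ^ n)) = (\<lambda>n. real (Suc n) * pmf q (Suc n))"
    using assms by (auto simp: fun_eq_iff)
  finally have "(\<lambda>n. real n * pmf q n) sums ((1 - a) / (1 - p) + real 0 * pmf q 0)"
    by (rule sums_Suc)
  then show ?thesis
    unfolding offspring_mean_def by (simp add: sums_iff)
qed

text \<open>
  With the parameters \<open>a\<close> and \<open>p\<close> of the law, \<open>A = p / (1 - a)\<close> and \<open>B = (1 - p) / (1 - a)\<close>. Both are
  expressed through the mean and the mass at \<open>0\<close>, which are the quantities in the hypotheses on the
  environment.
\<close>

lemma linear_fractional_lin_frac_gf:
  assumes "linear_fractional q"
  shows "lin_frac_gf (1 / (1 - pmf q 0) - exp (- log_mean q)) (exp (- log_mean q)) q"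
    and "pmf q 0 < 1"
proof -
  obtain a p where a: "0 \<le> a" "a < 1" and p: "0 < p" "p < 1" and q0: "pmf q 0 = a"
    and q: "\<forall>k\<ge>1. pmf q k = (1 - a) * (1 - p) / p * p ^ k"
    using assms unfolding linear_fractional_def by blast
  show "pmf q 0 < 1" using a q0 by simp
  have B: "exp (- log_mean q) = (1 - p) / (1 - a)"
    using a p by (simp add: log_mean_def linear_fractional_offspring_mean[OF p q] exp_minus)
  have A: "1 / (1 - pmf q 0) - exp (- log_mean q) = p / (1 - a)"
    using a by (simp add: B q0 field_simps)
  have "pmf_gf q s = 1 - (1 - s) / (p / (1 - a) * (1 - s) + (1 - p) / (1 - a))" if s: "\<bar>s\<bar> < 1" for s
  proof -
    have ps: "\<bar>p * s\<bar> < 1"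
      using p s mult_strict_mono'[of "\<bar>p\<bar>" 1 "\<bar>s\<bar>" 1] by (simp add: abs_mult)
    then have "(\<lambda>k. (p * s) ^ k) sums (1 / (1 - p * s))"
      by (intro geometric_sums) simp
    from sums_mult[OF this, of "(1 - a) * (1 - p) * s"]
    have "(\<lambda>k. pmf q (Suc k) * s ^ Suc k) sums ((1 - a) * (1 - p) * s / (1 - p * s))"
      using p q by (simp add: power_mult_distrib mult_ac)
    then have "(\<lambda>k. pmf q k * s ^ k) sums ((1 - a) * (1 - p) * s / (1 - p * s) + pmf q 0 * s ^ 0)"
      by (rule sums_Suc)
    then have "pmf_gf q s = (1 - a) * (1 - p) * s / (1 - p * s) + a"
      using pmf_gf_sums[of s q] s q0 sums_unique2 by fastforce
    also have "\<dots> = 1 - (1 - s) * (1 - a) / (1 - p * s)"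
      using ps by (simp add: divide_simps) (simp add: algebra_simps)
    also have "(1 - s) * (1 - a) / (1 - p * s) = (1 - s) / ((1 - p * s) / (1 - a))"
      by simp
    also have "(1 - p * s) / (1 - a) = p / (1 - a) * (1 - s) + (1 - p) / (1 - a)"
      using a by (simp add: field_simps)
    finally show ?thesis .
  qed
  then show "lin_frac_gf (1 / (1 - pmf q 0) - exp (- log_mean q)) (exp (- log_mean q)) q"
    unfolding A unfolding B lin_frac_gf_def using a p by auto
qed

definition env_walk :: "(nat \<Rightarrow> nat pmf) \<Rightarrow> nat \<Rightarrow> real" where
  "env_walk \<pi> n = (\<Sum>k<n. log_mean (\<pi> k))"

text \<open>
  For linear fractional environments this is the reciprocal of the quenched probability of survival
  up to time \<open>n\<close> (\<open>pmf_gen_law_linear_fractional\<close>). Each summand is nonnegative, so survival has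
  positive probability exactly if the series converges.
\<close>

definition inv_survival :: "(nat \<Rightarrow> nat pmf) \<Rightarrow> nat \<Rightarrow> real" where
  "inv_survival \<pi> n = 1 + (\<Sum>k<n. exp (- env_walk \<pi> k) * (1 / (1 - pmf (\<pi> k) 0) - 1))"

text \<open>
  The step from \<open>n\<close> to \<open>n + 1\<close> composes the affine maps \<open>x \<mapsto> A + B * x\<close> and \<open>x \<mapsto> a + b * x\<close> in the
  coordinate \<open>x = 1 / (1 - s)\<close>, which gives \<open>x \<mapsto> (A + B * a) + (B * b) * x\<close>.
\<close>

lemma lin_frac_gf_gen_law:
  assumes lf: "\<And>k. linear_fractional (\<pi> k)"
  shows "lin_frac_gf (inv_survival \<pi> n - exp (- env_walk \<pi> n)) (exp (- env_walk \<pi> n)) (gen_law \<pi> 1 n)"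
proof (induction n)
  case 0
  show ?case by (simp add: lin_frac_gf_def inv_survival_def env_walk_def)
next
  case (Suc n)
  define A where "A = inv_survival \<pi> n - exp (- env_walk \<pi> n)"
  define B where "B = exp (- env_walk \<pi> n)"
  define b where "b = exp (- log_mean (\<pi> n))"
  define a where "a = 1 / (1 - pmf (\<pi> n) 0) - b"
  have n: "0 \<le> A" "0 < B" "\<And>s. \<bar>s\<bar> < 1 \<Longrightarrow> pmf_gf (gen_law \<pi> 1 n) s = 1 - (1 - s) / (A * (1 - s) + B)"
    using Suc by (auto simp: lin_frac_gf_def A_def B_def)
  have s: "0 \<le> a" "0 < b" "\<And>s. \<bar>s\<bar> < 1 \<Longrightarrow> pmf_gf (\<pi> n) s = 1 - (1 - s) / (a * (1 - s) + b)"
    using linear_fractional_lin_frac_gf(1)[OF lf[of n]] by (auto simp: lin_frac_gf_def a_def b_def)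
  have B': "exp (- env_walk \<pi> (Suc n)) = B * b"
    by (simp add: B_def b_def env_walk_def flip: exp_add)
  have A': "inv_survival \<pi> (Suc n) - exp (- env_walk \<pi> (Suc n)) = A + B * a"
    unfolding B' by (simp add: inv_survival_def A_def B_def a_def algebra_simps)
  have "pmf_gf (gen_law \<pi> 1 (Suc n)) s = 1 - (1 - s) / ((A + B * a) * (1 - s) + B * b)"
    if t: "\<bar>s\<bar> < 1" for s
  proof -
    define u where "u = (1 - s) / (a * (1 - s) + b)"
    have pos: "0 < a * (1 - s) + b" "0 < 1 - s" using s t by (auto intro: add_nonneg_pos)
    then have u: "0 < u" by (simp add: u_def)
    have g: "pmf_gf (\<pi> n) s = 1 - u" using s(3)[OF t] by (simp add: u_def)
    have "pmf_gf (gen_law \<pi> 1 (Suc n)) s = pmf_gf (gen_law \<pi> 1 n) (1 - u)"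
      using t by (simp add: pmf_gf_gen_law_Suc g del: gen_law.simps)
    also have "\<dots> = 1 - u / (A * u + B)"
    \<comment> \<open>the expansion of the first \<open>n\<close> steps is known inside the unit interval only, and
      \<open>1 - u\<close> lies there because its modulus is at most the value at \<open>\<bar>s\<bar>\<close>\<close>
    proof -
      have "0 < a * (1 - \<bar>s\<bar>) + b" using s t by (intro add_nonneg_pos mult_nonneg_nonneg) auto
      then have "pmf_gf (\<pi> n) \<bar>s\<bar> < 1" using s(3)[of "\<bar>s\<bar>"] t by simp
      then have "\<bar>1 - u\<bar> < 1" using abs_pmf_gf_le_gf_abs[of "\<pi> n" s] t g by simp
      from n(3)[OF this] show ?thesis by simp
    qed
    also have "u / (A * u + B) = (1 - s) / (A * (1 - s) + B * (a * (1 - s) + b))"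
    proof -
      have "A * u + B = (A * (1 - s) + B * (a * (1 - s) + b)) / (a * (1 - s) + b)"
        using pos by (simp add: u_def field_simps)
      then show ?thesis using pos by (simp add: u_def)
    qed
    finally show ?thesis by (simp add: algebra_simps)
  qed
  then show ?case
    unfolding A' unfolding B' lin_frac_gf_def using n(1,2) s(1,2) by (simp del: gen_law.simps)
qed

lemma pmf_gen_law_linear_fractional:
  assumes "\<And>k. linear_fractional (\<pi> k)"
  shows "pmf (gen_law \<pi> 1 n) 0 = 1 - 1 / inv_survival \<pi> n"
    and "pmf (gen_law \<pi> 1 n) (Suc j) =
      exp (- env_walk \<pi> n) * (1 - pmf (gen_law \<pi> 1 n) 0)\<^sup>2 *
      (1 - exp (- env_walk \<pi> n) * (1 - pmf (gen_law \<pi> 1 n) 0)) ^ j"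
    and "exp (- env_walk \<pi> n) * (1 - pmf (gen_law \<pi> 1 n) 0) \<le> 1"
    and "1 \<le> inv_survival \<pi> n"
proof -
  note lf = lin_frac_gf_gen_law[of \<pi> n, OF assms]
  have AB: "exp (- env_walk \<pi> n) \<le> inv_survival \<pi> n"
    using lf by (simp add: lin_frac_gf_def)
  then have pos: "0 < inv_survival \<pi> n"
    by (meson exp_gt_zero less_le_trans)
  show z: "pmf (gen_law \<pi> 1 n) 0 = 1 - 1 / inv_survival \<pi> n"
    using lin_frac_gf_pmf[OF lf, of 0] by simp
  show "1 \<le> inv_survival \<pi> n"
    using z pos pmf_nonneg[of "gen_law \<pi> 1 n" 0] by simp
  show "exp (- env_walk \<pi> n) * (1 - pmf (gen_law \<pi> 1 n) 0) \<le> 1"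
    using AB pos unfolding z by simp
  show "pmf (gen_law \<pi> 1 n) (Suc j) =
      exp (- env_walk \<pi> n) * (1 - pmf (gen_law \<pi> 1 n) 0)\<^sup>2 *
      (1 - exp (- env_walk \<pi> n) * (1 - pmf (gen_law \<pi> 1 n) 0)) ^ j"
    using lin_frac_gf_pmf[OF lf, of "Suc j"] pos unfolding z by (simp add: power_divide diff_divide_distrib)
qed

section \<open>The quenched law\<close>

lemma quenched_law_measurable_component [measurable]:
  "(\<lambda>x. x n) \<in> measurable (quenched_law \<pi> z0) (count_space UNIV)"
  by (subst measurable_cong_sets[OF sets_quenched_law refl]) (rule measurable_component_singleton, simp)

text \<open>
  The finite-dimensional distributions only concern complete paths, so the event is split into the
  countably many cylinders that fix the path up to time \<open>n\<close>.
\<close>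

lemma quenched_law_step:
  "emeasure (quenched_law \<pi> z0) {x. x n = i \<and> x (Suc n) = j} =
    emeasure (quenched_law \<pi> z0) {x. x n = i} * ennreal (pmf (conv_power (\<pi> n) i) j)"
proof -
  define L where "L = quenched_law \<pi> z0"
  have [measurable]: "(\<lambda>x. x m) \<in> measurable L (count_space UNIV)" for m
    unfolding L_def by measurable
  have spL: "space L = UNIV" by (simp add: L_def space_quenched_law)
  have meas: "{x. P x} \<in> sets L" if "Measurable.pred L P" for P
    using that spL by (simp add: pred_def)
  define I :: "(nat \<Rightarrow> nat) set" where "I = {y \<in> PiE {..n} (\<lambda>_. UNIV). y n = i}"
  have cI: "countable I"
    unfolding I_def by (rule countable_subset[OF _ countable_PiE[of "{..n}" "\<lambda>_. UNIV"]]) auto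
  define C where "C y = {x. \<forall>k\<le>n. x k = y k}" for y :: "nat \<Rightarrow> nat"
  have C: "C y \<in> sets L" for y unfolding C_def by (rule meas) measurable
  have C': "C y \<inter> {x. x (Suc n) = j} \<in> sets L" for y
    by (intro sets.Int C meas) measurable
  have disj: "disjoint_family_on C I"
    unfolding disjoint_family_on_def
  proof (intro ballI impI)
    fix y y' assume y: "y \<in> I" "y' \<in> I" "y \<noteq> y'"
    have "\<exists>k\<le>n. y k \<noteq> y' k"
    proof (rule ccontr)
      assume "\<not> (\<exists>k\<le>n. y k \<noteq> y' k)"
      then have "y = y'" using y by (intro PiE_ext[of y "{..n}"]) (auto simp: I_def)
      with y show False by simp
    qed
    then show "C y \<inter> C y' = {}" by (auto simp: C_def)
  qed
  then have disj': "disjoint_family_on (\<lambda>y. C y \<inter> {x. x (Suc n) = j}) I"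
    by (auto simp: disjoint_family_on_def)
  have un: "{x. x n = i} = (\<Union>y\<in>I. C y)"
  proof (intro set_eqI iffI)
    fix x :: "nat \<Rightarrow> nat" assume "x \<in> {x. x n = i}"
    then have "restrict x {..n} \<in> I" "x \<in> C (restrict x {..n})" by (auto simp: I_def C_def)
    then show "x \<in> (\<Union>y\<in>I. C y)" by blast
  qed (auto simp: I_def C_def)
  then have un': "{x. x n = i \<and> x (Suc n) = j} = (\<Union>y\<in>I. C y \<inter> {x. x (Suc n) = j})" by auto
  have step: "emeasure L (C y \<inter> {x. x (Suc n) = j}) = emeasure L (C y) * ennreal (pmf (conv_power (\<pi> n) i) j)"
    if "y \<in> I" for y
  proof -
    have "C y \<inter> {x. x (Suc n) = j} = {x. \<forall>k\<le>Suc n. x k = (y(Suc n := j)) k}"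
      by (auto simp: C_def le_Suc_eq)
    then show ?thesis
      using that unfolding C_def L_def
      by (simp add: quenched_law_fdd I_def ennreal_mult prod_nonneg del: fun_upd_apply)
         (auto intro!: arg_cong2[where f = "(*)"] prod.cong simp: ennreal_mult prod_nonneg)
  qed
  have "emeasure L {x. x n = i \<and> x (Suc n) = j} =
      (\<integral>\<^sup>+y. emeasure L (C y) * ennreal (pmf (conv_power (\<pi> n) i) j) \<partial>count_space I)"
    unfolding un' using C' step
    by (subst emeasure_UN_countable[OF _ cI disj']) (auto intro!: nn_integral_cong)
  also have "\<dots> = emeasure L {x. x n = i} * ennreal (pmf (conv_power (\<pi> n) i) j)"
    unfolding un using C by (subst emeasure_UN_countable[OF _ cI disj]) (auto simp: nn_integral_multc)
  finally show ?thesis unfolding L_def .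
qed

lemma quenched_law_marginal:
  "emeasure (quenched_law \<pi> z0) {x. x n = j} = ennreal (pmf (gen_law \<pi> z0 n) j)"
proof (induction n arbitrary: j)
  case 0
  have "{x :: nat \<Rightarrow> nat. x 0 = j} = {x. \<forall>i\<le>0. x i = (\<lambda>_. j) i}" by (auto simp: fun_eq_iff)
  then show ?case
    using quenched_law_fdd[of \<pi> z0 0 "\<lambda>_. j"] by (auto simp: pmf_return indicator_def)
next
  case (Suc n)
  have meas: "{x. P x} \<in> sets (quenched_law \<pi> z0)" if "Measurable.pred (quenched_law \<pi> z0) P" for P
    using that by (simp add: pred_def space_quenched_law)
  have "{x. x (Suc n) = j} = (\<Union>i. {x. x n = i \<and> x (Suc n) = j})" by auto
  then have "emeasure (quenched_law \<pi> z0) {x. x (Suc n) = j} =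
      (\<integral>\<^sup>+i. emeasure (quenched_law \<pi> z0) {x. x n = i \<and> x (Suc n) = j} \<partial>count_space UNIV)"
    by (simp only:) (rule emeasure_UN_countable, auto intro!: meas simp: disjoint_family_on_def)
  also have "\<dots> = ennreal (pmf (gen_law \<pi> z0 (Suc n)) j)"
    by (simp add: quenched_law_step Suc ennreal_pmf_bind nn_integral_measure_pmf)
  finally show ?case .
qed

text \<open>
  Since \<open>0\<close> is absorbing, surviving at all times up to \<open>n\<close> is the same as being alive at time \<open>n\<close>.
\<close>

lemma survival_prob_limit:
  "(\<lambda>n. 1 - pmf (gen_law \<pi> 1 n) 0) \<longlonglongrightarrow> survival_prob \<pi>"
proof -
  define L where "L = quenched_law \<pi> 1"
  interpret L: prob_space L unfolding L_def by (rule prob_space_quenched_law)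
  have [measurable]: "(\<lambda>x. x m) \<in> measurable L (count_space UNIV)" for m
    unfolding L_def by measurable
  have spL: "space L = UNIV" by (simp add: L_def space_quenched_law)
  have meas: "{x. P x} \<in> sets L" if "Measurable.pred L P" for P
    using that spL by (simp add: pred_def)
  define A where "A n = {x. \<forall>i\<in>{1..Suc n}. x i > (0::nat)}" for n
  have A: "A n \<in> sets L" for n unfolding A_def by (rule meas) measurable
  have "(\<lambda>n. measure L (A n)) \<longlonglongrightarrow> measure L (\<Inter>n. A n)"
    using A by (intro L.finite_Lim_measure_decseq) (auto simp: decseq_def A_def)
  also have "(\<Inter>n. A n) = {x \<in> space L. \<forall>n\<ge>1. x n > 0}"
    unfolding spL A_def by (auto simp: le_Suc_eq) (metis One_nat_def Suc_le_D atLeastAtMost_iff order_refl)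
  also have "measure L \<dots> = survival_prob \<pi>"
    by (simp add: survival_prob_def L_def)
  finally have lim: "(\<lambda>n. measure L (A n)) \<longlonglongrightarrow> survival_prob \<pi>" .
  have "measure L (A n) = 1 - pmf (gen_law \<pi> 1 (Suc n)) 0" for n
  proof -
    have "AE x in L. x m = 0 \<longrightarrow> x (Suc m) = 0" for m
    proof -
      have "AE x in L. \<not> (x m = 0 \<and> x (Suc m) = Suc j)" for j
        using quenched_law_step[of \<pi> 1 m 0 "Suc j"] unfolding L_def[symmetric]
        by (intro AE_I[where N = "{x. x m = 0 \<and> x (Suc m) = Suc j}"] meas) auto
      then have "AE x in L. \<forall>j. \<not> (x m = 0 \<and> x (Suc m) = Suc j)"
        unfolding AE_all_countable by blast
      then show ?thesis by eventually_elim (metis not0_implies_Suc)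
    qed
    then have "AE x in L. \<forall>m. x m = 0 \<longrightarrow> x (Suc m) = 0"
      unfolding AE_all_countable by blast
    then have "AE x in L. x \<in> A n \<longleftrightarrow> x \<in> {x. x (Suc n) \<noteq> 0}"
    proof eventually_elim
      case (elim x)
      have "x (i + d) = 0" if "x i = 0" for i d
        by (induction d) (use that elim in auto)
      then have "x (Suc n) = 0" if "x i = 0" "i \<le> Suc n" for i
        using that le_add_diff_inverse[of i "Suc n"] by metis
      then show ?case by (force simp: A_def)
    qed
    then have "measure L (A n) = measure L {x. x (Suc n) \<noteq> 0}"
      by (intro L.finite_measure_eq_AE A meas) auto
    also have "\<dots> = 1 - measure L {x. x (Suc n) = 0}"
      by (subst L.prob_compl[symmetric]) (auto intro!: meas arg_cong[where f = "measure L"] simp: spL)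
    also have "measure L {x. x (Suc n) = 0} = pmf (gen_law \<pi> 1 (Suc n)) 0"
      unfolding measure_def L_def quenched_law_marginal by simp
    finally show ?thesis .
  qed
  then have "(\<lambda>n. 1 - pmf (gen_law \<pi> 1 (Suc n)) 0) \<longlonglongrightarrow> survival_prob \<pi>"
    using lim by simp
  then show ?thesis by (rule LIMSEQ_imp_Suc)
qed

lemma extinction_prob_eq: "extinction_prob \<pi> = 1 - survival_prob \<pi>"
proof -
  interpret L: prob_space "quenched_law \<pi> 1" by (rule prob_space_quenched_law)
  show ?thesis
    unfolding extinction_prob_def survival_prob_def
    by (rule L.prob_neg) measurable
qed

section \<open>I.i.d. sequences\<close>

context sequence_space
begin

lemma measurable_shift [measurable]: "(\<lambda>\<omega> i. \<omega> (Suc i)) \<in> measurable S S"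
  by (rule measurable_PiM_single') (auto simp: space_PiM)

lemma distr_shift: "distr S S (\<lambda>\<omega> i. \<omega> (Suc i)) = S"
  using distr_PiM_reindex[of UNIV "\<lambda>_. M" Suc UNIV] M.prob_space_axioms by (simp add: o_def restrict_def)

lemma nn_integral_iter:
  assumes [measurable]: "h \<in> borel_measurable S"
  shows "(\<integral>\<^sup>+\<omega>. h \<omega> \<partial>S) = (\<integral>\<^sup>+s. (\<integral>\<^sup>+\<omega>. h (case_nat s \<omega>) \<partial>S) \<partial>M)"
proof -
  have "(\<integral>\<^sup>+\<omega>. h \<omega> \<partial>S) = (\<integral>\<^sup>+\<omega>. h \<omega> \<partial>distr (M \<Otimes>\<^sub>M S) S (\<lambda>(s, \<omega>). case_nat s \<omega>))"
    by (simp only: PiM_iter)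
  also have "\<dots> = (\<integral>\<^sup>+x. h ((\<lambda>(s, \<omega>). case_nat s \<omega>) x) \<partial>(M \<Otimes>\<^sub>M S))"
    by (rule nn_integral_distr) measurable
  also have "\<dots> = (\<integral>\<^sup>+s. (\<integral>\<^sup>+\<omega>. h (case_nat s \<omega>) \<partial>S) \<partial>M)"
    by (subst P.nn_integral_fst[symmetric]) auto
  finally show ?thesis .
qed

lemma nn_integral_split:
  assumes [measurable]: "h \<in> borel_measurable S"
  shows "(\<integral>\<^sup>+\<omega>. h \<omega> \<partial>S) = (\<integral>\<^sup>+\<omega>. (\<integral>\<^sup>+\<omega>'. h (comb_seq n \<omega> \<omega>') \<partial>S) \<partial>S)"
proof -
  have "(\<integral>\<^sup>+\<omega>. h \<omega> \<partial>S) = (\<integral>\<^sup>+\<omega>. h \<omega> \<partial>distr (S \<Otimes>\<^sub>M S) S (\<lambda>(\<omega>, \<omega>'). comb_seq n \<omega> \<omega>'))"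
    by (simp only: PiM_comb_seq)
  also have "\<dots> = (\<integral>\<^sup>+x. h ((\<lambda>(\<omega>, \<omega>'). comb_seq n \<omega> \<omega>') x) \<partial>(S \<Otimes>\<^sub>M S))"
    by (rule nn_integral_distr) measurable
  also have "\<dots> = (\<integral>\<^sup>+\<omega>. (\<integral>\<^sup>+\<omega>'. h (comb_seq n \<omega> \<omega>') \<partial>S) \<partial>S)"
    by (subst P.nn_integral_fst[symmetric]) auto
  finally show ?thesis .
qed

lemma nn_integral_future_indep:
  assumes [measurable]: "f \<in> borel_measurable S" "g \<in> borel_measurable S"
    and f: "\<And>\<omega> \<omega>'. (\<And>i. i < n \<Longrightarrow> \<omega> i = \<omega>' i) \<Longrightarrow> f \<omega> = f \<omega>'"
  shows "(\<integral>\<^sup>+\<omega>. f \<omega> * g (\<lambda>i. \<omega> (n + i)) \<partial>S) = (\<integral>\<^sup>+\<omega>. f \<omega> \<partial>S) * (\<integral>\<^sup>+\<omega>. g \<omega> \<partial>S)"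
proof -
  have [measurable]: "(\<lambda>\<omega> i. \<omega> (n + i)) \<in> measurable S S"
    by (rule measurable_PiM_single') (auto simp: space_PiM)
  have "f (comb_seq n \<omega> \<omega>') = f \<omega>" for \<omega> \<omega>'
    by (rule f) (simp add: comb_seq_less)
  moreover have "comb_seq n \<omega> \<omega>' (n + i) = \<omega>' i" for \<omega> \<omega>' :: "nat \<Rightarrow> 'a" and i
    using comb_seq_add[of n \<omega> \<omega>' i] by (simp add: add.commute)
  ultimately have "(\<integral>\<^sup>+\<omega>. f \<omega> * g (\<lambda>i. \<omega> (n + i)) \<partial>S) = (\<integral>\<^sup>+\<omega>. (\<integral>\<^sup>+\<omega>'. f \<omega> * g \<omega>' \<partial>S) \<partial>S)"
    by (subst nn_integral_split[of _ n]) (simp_all only:, measurable)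
  also have "\<dots> = (\<integral>\<^sup>+\<omega>. f \<omega> \<partial>S) * (\<integral>\<^sup>+\<omega>. g \<omega> \<partial>S)"
    by (simp add: nn_integral_cmult nn_integral_multc)
  finally show ?thesis .
qed

text \<open>
  Change of measure for finitely many coordinates. An infinite product of densities has no meaning
  in general, so the functional must only look at the coordinates whose densities are included.
\<close>

lemma nn_integral_density_iid:
  assumes w [measurable]: "w \<in> borel_measurable M" and w1: "(\<integral>\<^sup>+x. w x \<partial>M) = 1"
    and "h \<in> borel_measurable S"
    and "\<And>\<omega> \<omega>'. (\<And>i. i < n \<Longrightarrow> \<omega> i = \<omega>' i) \<Longrightarrow> h \<omega> = h \<omega>'"
  shows "(\<integral>\<^sup>+\<omega>. (\<Prod>i<n. w (\<omega> i)) * h \<omega> \<partial>S) = (\<integral>\<^sup>+\<omega>. h \<omega> \<partial>PiM UNIV (\<lambda>_. density M w))"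
  using assms(3,4)
proof (induction n arbitrary: h)
  interpret D: prob_space "density M w"
    by (rule prob_spaceI) (simp add: emeasure_density w1 cong: nn_integral_cong)
  interpret D: sequence_space "density M w" by unfold_locales
  {
    case 0
    have "h = (\<lambda>_. h undefined)" by (rule ext, rule 0) simp
    then obtain c where c: "h = (\<lambda>_. c)" by (rule that)
    show ?case
      unfolding c by (simp only: lessThan_0 prod.empty mult_1 nn_integral_const
        P.emeasure_space_1 D.P.emeasure_space_1)
  next
    case (Suc n)
    note [measurable] = Suc.prems(1)
    have h': "(\<lambda>\<omega>. h (case_nat s \<omega>)) \<in> borel_measurable S" if "s \<in> space M" for s
      using that by measurable
    have "(\<integral>\<^sup>+\<omega>. (\<Prod>i<Suc n. w (\<omega> i)) * h \<omega> \<partial>S) =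
        (\<integral>\<^sup>+s. (\<integral>\<^sup>+\<omega>. (\<Prod>i<Suc n. w (case_nat s \<omega> i)) * h (case_nat s \<omega>) \<partial>S) \<partial>M)"
      by (rule nn_integral_iter) measurable
    also have "\<dots> = (\<integral>\<^sup>+s. (\<integral>\<^sup>+\<omega>. w s * ((\<Prod>i<n. w (\<omega> i)) * h (case_nat s \<omega>)) \<partial>S) \<partial>M)"
      by (simp only: prod.lessThan_Suc_shift nat.case mult.assoc)
    also have "\<dots> = (\<integral>\<^sup>+s. w s * (\<integral>\<^sup>+\<omega>. h (case_nat s \<omega>) \<partial>PiM UNIV (\<lambda>_. density M w)) \<partial>M)"
    proof (rule nn_integral_cong)
      fix s assume s: "s \<in> space M"
      have "(\<integral>\<^sup>+\<omega>. (\<Prod>i<n. w (\<omega> i)) * h (case_nat s \<omega>) \<partial>S) =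
          (\<integral>\<^sup>+\<omega>. h (case_nat s \<omega>) \<partial>PiM UNIV (\<lambda>_. density M w))"
        by (intro Suc.IH h' s Suc.prems(2)) (auto split: nat.split simp: less_Suc_eq_0_disj)
      moreover have "(\<integral>\<^sup>+\<omega>. w s * ((\<Prod>i<n. w (\<omega> i)) * h (case_nat s \<omega>)) \<partial>S) =
          w s * (\<integral>\<^sup>+\<omega>. (\<Prod>i<n. w (\<omega> i)) * h (case_nat s \<omega>) \<partial>S)"
      proof (rule nn_integral_cmult)
        have "(\<lambda>\<omega>. \<Prod>i<n. w (\<omega> i)) \<in> borel_measurable S" by measurable
        then show "(\<lambda>\<omega>. (\<Prod>i<n. w (\<omega> i)) * h (case_nat s \<omega>)) \<in> borel_measurable S"
          using h'[OF s] by (rule borel_measurable_times_ennreal)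
      qed
      ultimately show "(\<integral>\<^sup>+\<omega>. w s * ((\<Prod>i<n. w (\<omega> i)) * h (case_nat s \<omega>)) \<partial>S) =
          w s * (\<integral>\<^sup>+\<omega>. h (case_nat s \<omega>) \<partial>PiM UNIV (\<lambda>_. density M w))"
        by (simp only:)
    qed
    also have "\<dots> = (\<integral>\<^sup>+s. (\<integral>\<^sup>+\<omega>. h (case_nat s \<omega>) \<partial>D.S) \<partial>density M w)"
      by (subst nn_integral_density) measurable
    also have "\<dots> = (\<integral>\<^sup>+\<omega>. h \<omega> \<partial>D.S)"
      by (rule D.nn_integral_iter[symmetric]) measurable
    finally show ?case .
  }
qed

lemma integral_iter:
  fixes h :: "_ \<Rightarrow> real"
  assumes "integrable S h"
  shows "(\<integral>\<omega>. h \<omega> \<partial>S) = (\<integral>s. (\<integral>\<omega>. h (case_nat s \<omega>) \<partial>S) \<partial>M)"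
proof -
  have [measurable]: "h \<in> borel_measurable S" using assms by auto
  interpret MS: pair_sigma_finite M S ..
  have "integrable (distr (M \<Otimes>\<^sub>M S) S (\<lambda>(s, \<omega>). case_nat s \<omega>)) h"
    using assms by (simp only: PiM_iter)
  then have int: "integrable (M \<Otimes>\<^sub>M S) (\<lambda>x. h ((\<lambda>(s, \<omega>). case_nat s \<omega>) x))"
    by (subst (asm) integrable_distr_eq) measurable
  have "(\<integral>\<omega>. h \<omega> \<partial>S) = (\<integral>\<omega>. h \<omega> \<partial>distr (M \<Otimes>\<^sub>M S) S (\<lambda>(s, \<omega>). case_nat s \<omega>))"
    by (simp only: PiM_iter)
  also have "\<dots> = (\<integral>x. h ((\<lambda>(s, \<omega>). case_nat s \<omega>) x) \<partial>(M \<Otimes>\<^sub>M S))"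
    by (rule integral_distr) measurable
  also have "\<dots> = (\<integral>s. (\<integral>\<omega>. h (case_nat s \<omega>) \<partial>S) \<partial>M)"
    using MS.integral_fst'[OF int] by simp
  finally show ?thesis .
qed

lemma integrable_coordinate:
  fixes f :: "_ \<Rightarrow> real"
  assumes "integrable M f"
  shows "integrable S (\<lambda>\<omega>. f (\<omega> k))"
proof -
  have [measurable]: "f \<in> borel_measurable M" using assms by auto
  have "distr S M (\<lambda>\<omega>. \<omega> k) = M"
    using distr_PiM_component[of UNIV "\<lambda>_. M" k] M.prob_space_axioms by simp
  then have "integrable (distr S M (\<lambda>\<omega>. \<omega> k)) f" using assms by simp
  then show ?thesis by (subst (asm) integrable_distr_eq) auto
qed

lemma integrable_shift:
  fixes h :: "_ \<Rightarrow> real"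
  assumes "integrable S h"
  shows "integrable S (\<lambda>\<omega>. h (\<lambda>i. \<omega> (Suc i)))" "(\<integral>\<omega>. h (\<lambda>i. \<omega> (Suc i)) \<partial>S) = (\<integral>\<omega>. h \<omega> \<partial>S)"
proof -
  have "integrable (distr S S (\<lambda>\<omega> i. \<omega> (Suc i))) h"
    using assms by (simp only: distr_shift)
  then show "integrable S (\<lambda>\<omega>. h (\<lambda>i. \<omega> (Suc i)))"
    by (subst (asm) integrable_distr_eq) (use assms in auto)
  have "(\<integral>\<omega>. h \<omega> \<partial>S) = (\<integral>\<omega>. h \<omega> \<partial>distr S S (\<lambda>\<omega> i. \<omega> (Suc i)))"
    by (simp only: distr_shift)
  also have "\<dots> = (\<integral>\<omega>. h (\<lambda>i. \<omega> (Suc i)) \<partial>S)"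
    by (rule integral_distr) (use assms in auto)
  finally show "(\<integral>\<omega>. h (\<lambda>i. \<omega> (Suc i)) \<partial>S) = (\<integral>\<omega>. h \<omega> \<partial>S)" ..
qed

end

section \<open>Random walks with positive drift\<close>

text \<open>
  The minimum over \<open>k \<le> n\<close> of \<open>(\<Sum>j<k. X (\<omega> j)) - Y (\<omega> k)\<close>, written as the recursion obtained by
  splitting off the first step. The recursion relates the minimum for \<open>\<omega>\<close> to the minimum for the
  shifted sequence, which has the same distribution.
\<close>

primrec penalised_min :: "('a \<Rightarrow> real) \<Rightarrow> ('a \<Rightarrow> real) \<Rightarrow> nat \<Rightarrow> (nat \<Rightarrow> 'a) \<Rightarrow> real" where
  "penalised_min X Y 0 \<omega> = - Y (\<omega> 0)"
| "penalised_min X Y (Suc n) \<omega> = min (- Y (\<omega> 0)) (X (\<omega> 0) + penalised_min X Y n (\<lambda>i. \<omega> (Suc i)))"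

lemma penalised_min_le:
  "k \<le> n \<Longrightarrow> penalised_min X Y n \<omega> \<le> (\<Sum>j<k. X (\<omega> j)) - Y (\<omega> k)"
proof (induction n arbitrary: k \<omega>)
  case (Suc n)
  show ?case
  proof (cases k)
    case (Suc k')
    have "(\<Sum>j<k. X (\<omega> j)) = X (\<omega> 0) + (\<Sum>j<k'. X (\<omega> (Suc j)))"
      unfolding Suc by (rule sum.lessThan_Suc_shift)
    then show ?thesis
      using Suc.IH[of k' "\<lambda>i. \<omega> (Suc i)"] Suc.prems Suc by simp
  qed simp
qed simp

lemma penalised_min_antimono: "penalised_min X Y (Suc n) \<omega> \<le> penalised_min X Y n \<omega>"
proof (induction n arbitrary: \<omega>)
  case (Suc n)
  show ?case using Suc[of "\<lambda>i. \<omega> (Suc i)"] by simp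
qed simp

text \<open>
  A variant of Garsia's proof of the maximal ergodic inequality. Let \<open>U n\<close> be the penalised
  minimum, \<open>\<theta>\<close> the shift, \<open>B\<close> the event that the penalised walk is unbounded below, and \<open>A n\<close> the
  event that the minimum up to time \<open>n + 1\<close> is not attained at time \<open>0\<close>. On \<open>A n\<close> the recursion reads
  \<open>X (\<omega> 0) = U (Suc n) \<omega> - U n (\<theta> \<omega>)\<close>, whereas off \<open>A n\<close> the left side can be replaced by
  \<open>- Y (\<omega> 0)\<close> and the equation by \<open>\<le>\<close>. Integrated over the shift-invariant event \<open>B\<close>, the right side
  is at most \<open>0\<close>, because the shift preserves the measure and \<open>U\<close> decreases in \<open>n\<close>. As \<open>n\<close> grows, \<open>A n \<inter> B\<close>
  exhausts \<open>B\<close>, so the integral of \<open>X (\<omega> 0)\<close> over \<open>B\<close> is at most \<open>0\<close>. But \<open>B\<close> depends on the shifted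
  sequence alone and is independent of the first coordinate, so this integral is the positive mean
  of \<open>X\<close> times the probability of \<open>B\<close>.
\<close>

lemma (in sequence_space) penalised_walk_bounded_below:
  fixes X Y :: "'a \<Rightarrow> real"
  assumes X: "integrable M X" and Y: "integrable M Y" and Y0: "\<And>x. 0 \<le> Y x"
    and drift: "0 < (\<integral>x. X x \<partial>M)"
  shows "AE \<omega> in S. \<exists>c. \<forall>k. c \<le> (\<Sum>j<k. X (\<omega> j)) - Y (\<omega> k)"
proof -
  have [measurable]: "X \<in> borel_measurable M" "Y \<in> borel_measurable M" using X Y by auto
  define \<theta> :: "(nat \<Rightarrow> 'a) \<Rightarrow> nat \<Rightarrow> 'a" where "\<theta> \<omega> = (\<lambda>i. \<omega> (Suc i))" for \<omega>
  define U where "U = penalised_min X Y"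
  have U_Suc: "U (Suc n) \<omega> = min (- Y (\<omega> 0)) (X (\<omega> 0) + U n (\<theta> \<omega>))" for n \<omega>
    by (simp add: U_def \<theta>_def)
  have U_int: "integrable S (U n)" for n
  proof (induction n)
    case 0
    show ?case using integrable_coordinate[OF Y, of 0] by (simp add: U_def)
  next
    case (Suc n)
    show ?case
      using integrable_coordinate[OF Y, of 0] integrable_coordinate[OF X, of 0] integrable_shift(1)[OF Suc]
      unfolding U_Suc \<theta>_def by (intro integrable_min Bochner_Integration.integrable_add) auto
  qed
  then have [measurable]: "U n \<in> borel_measurable S" for n by auto
  have U_le: "U n \<omega> \<le> 0" for n \<omega>
    using Y0[of "\<omega> 0"] by (cases n) (auto simp: U_def min_def)
  \<comment> \<open>the bounds range over the natural numbers so that \<open>B\<close> is visibly measurable\<close>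
  define B where "B = {\<omega> \<in> space S. \<not> (\<exists>c::nat. \<forall>k. - real c \<le> (\<Sum>j<k. X (\<omega> j)) - Y (\<omega> k))}"
  have B [measurable]: "B \<in> sets S" unfolding B_def by measurable
  have B_shift: "case_nat s \<omega> \<in> B \<longleftrightarrow> \<omega> \<in> B" if s: "s \<in> space M" and \<omega>: "\<omega> \<in> space S" for s \<omega>
  proof -
    have "(\<exists>c::nat. \<forall>k. - real c \<le> (\<Sum>j<k. X (case_nat s \<omega> j)) - Y (case_nat s \<omega> k)) \<longleftrightarrow>
        (\<exists>c::nat. \<forall>k. - real c \<le> (\<Sum>j<k. X (\<omega> j)) - Y (\<omega> k))" (is "?L \<longleftrightarrow> ?R")
    proof
      have eq: "(\<Sum>j<Suc k. X (case_nat s \<omega> j)) = X s + (\<Sum>j<k. X (\<omega> j))" for k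
        by (simp add: sum.lessThan_Suc_shift del: sum.lessThan_Suc)
      show ?R if L: ?L
      proof -
        obtain c :: nat where c: "\<And>k. - real c \<le> (\<Sum>j<k. X (case_nat s \<omega> j)) - Y (case_nat s \<omega> k)"
          using L by blast
        obtain d :: nat where "real c + X s \<le> real d" using real_arch_simple by blast
        then have "- real d \<le> (\<Sum>j<k. X (\<omega> j)) - Y (\<omega> k)" for k
          using c[of "Suc k"] eq[of k] by simp
        then show ?R by blast
      qed
      show ?L if R: ?R
      proof -
        obtain c :: nat where c: "\<And>k. - real c \<le> (\<Sum>j<k. X (\<omega> j)) - Y (\<omega> k)"
          using R by blast
        obtain d :: nat where d: "max (real c - X s) (Y s) \<le> real d" using real_arch_simple by blast
        have "- real d \<le> (\<Sum>j<k. X (case_nat s \<omega> j)) - Y (case_nat s \<omega> k)" for k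
          using d c[of "k - 1"] eq[of "k - 1"] by (cases k) auto
        then show ?L by blast
      qed
    qed
    moreover have "case_nat s \<omega> \<in> space S"
      using s \<omega> by (auto simp: space_PiM PiE_iff split: nat.split)
    ultimately show ?thesis
      using \<omega> by (simp only: B_def mem_Collect_eq simp_thms)
  qed
  have B_\<theta>: "\<theta> \<omega> \<in> B \<longleftrightarrow> \<omega> \<in> B" if "\<omega> \<in> space S" for \<omega>
  proof -
    have "\<omega> = case_nat (\<omega> 0) (\<theta> \<omega>)" by (auto simp: fun_eq_iff \<theta>_def split: nat.split)
    then show ?thesis
      using B_shift[of "\<omega> 0" "\<theta> \<omega>"] that by (auto simp: space_PiM \<theta>_def)
  qed
  define A where "A n = {\<omega> \<in> space S. U (Suc n) \<omega> < - Y (\<omega> 0)}" for n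
  have A [measurable]: "A n \<in> sets S" for n unfolding A_def by measurable
  let ?f = "\<lambda>n \<omega>. (X (\<omega> 0) * indicator (A n) \<omega> - Y (\<omega> 0) * indicator (space S - A n) \<omega>) * indicator B \<omega> :: real"
  have int_le: "(\<integral>\<omega>. ?f n \<omega> \<partial>S) \<le> 0" for n
  proof -
    have i1: "integrable S (\<lambda>\<omega>. U n \<omega> * indicator B \<omega>)" for n
      using integrable_mult_indicator[OF B U_int[of n]] by (simp add: mult.commute)
    have i2: "integrable S (\<lambda>\<omega>. U n (\<theta> \<omega>) * indicator B (\<theta> \<omega>))"
      "(\<integral>\<omega>. U n (\<theta> \<omega>) * indicator B (\<theta> \<omega>) \<partial>S) = (\<integral>\<omega>. U n \<omega> * indicator B \<omega> \<partial>S)"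
      using integrable_shift[OF i1[of n]] unfolding \<theta>_def by auto
    have "integrable S (?f n)"
      by (rule Bochner_Integration.integrable_bound[where f = "\<lambda>\<omega>. \<bar>X (\<omega> 0)\<bar> + Y (\<omega> 0)"])
         (use integrable_coordinate[OF X, of 0] integrable_coordinate[OF Y, of 0] Y0 in
           \<open>auto simp: indicator_def\<close>)
    then have "(\<integral>\<omega>. ?f n \<omega> \<partial>S) \<le>
        (\<integral>\<omega>. U (Suc n) \<omega> * indicator B \<omega> - U n (\<theta> \<omega>) * indicator B (\<theta> \<omega>) \<partial>S)"
    proof (rule integral_mono)
      show "integrable S (\<lambda>\<omega>. U (Suc n) \<omega> * indicator B \<omega> - U n (\<theta> \<omega>) * indicator B (\<theta> \<omega>))"
        using i1 i2 by auto
      fix \<omega> assume "\<omega> \<in> space S"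
      then show "?f n \<omega> \<le> U (Suc n) \<omega> * indicator B \<omega> - U n (\<theta> \<omega>) * indicator B (\<theta> \<omega>)"
        using U_le[of n "\<theta> \<omega>"] B_\<theta>[of \<omega>] by (auto simp: indicator_def A_def U_Suc min_def)
    qed
    also have "\<dots> = (\<integral>\<omega>. U (Suc n) \<omega> * indicator B \<omega> \<partial>S) - (\<integral>\<omega>. U n \<omega> * indicator B \<omega> \<partial>S)"
      using i1 i2 by simp
    also have "\<dots> \<le> 0"
      using integral_mono[OF i1[of "Suc n"] i1[of n]] penalised_min_antimono[of X Y n]
      by (simp add: U_def mult_right_mono del: penalised_min.simps)
    finally show ?thesis .
  qed
  have "(\<lambda>n. \<integral>\<omega>. ?f n \<omega> \<partial>S) \<longlonglongrightarrow> (\<integral>\<omega>. X (\<omega> 0) * indicator B \<omega> \<partial>S)"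
  proof (rule integral_dominated_convergence[where w = "\<lambda>\<omega>. \<bar>X (\<omega> 0)\<bar> + Y (\<omega> 0)"])
    show "AE \<omega> in S. (\<lambda>n. ?f n \<omega>) \<longlonglongrightarrow> X (\<omega> 0) * indicator B \<omega>"
    proof (rule AE_I2)
      fix \<omega> assume \<omega>: "\<omega> \<in> space S"
      show "(\<lambda>n. ?f n \<omega>) \<longlonglongrightarrow> X (\<omega> 0) * indicator B \<omega>"
      proof (cases "\<omega> \<in> B")
        case True
        have "\<exists>n. \<omega> \<in> A n"
        proof (rule ccontr)
          assume "\<not> (\<exists>n. \<omega> \<in> A n)"
          then have ge: "- Y (\<omega> 0) \<le> U (Suc k) \<omega>" for k using \<omega> by (auto simp: A_def not_less)
          obtain c :: nat where "Y (\<omega> 0) \<le> real c" using real_arch_simple by blast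
          then have "- real c \<le> (\<Sum>j<k. X (\<omega> j)) - Y (\<omega> k)" for k
            using ge[of k] penalised_min_le[of k "Suc k" X Y \<omega>] by (simp add: U_def)
          then show False using True by (auto simp: B_def)
        qed
        then obtain n where n: "\<omega> \<in> A n" ..
        have "\<omega> \<in> A m" if "n \<le> m" for m
          using that n by (induction m rule: dec_induct)
            (use penalised_min_antimono[of X Y _ \<omega>] in
              \<open>auto simp: A_def U_def simp del: penalised_min.simps intro: le_less_trans\<close>)
        then have "eventually (\<lambda>m. X (\<omega> 0) * indicator B \<omega> = ?f m \<omega>) sequentially"
          by (intro eventually_sequentiallyI[of n]) auto
        then show ?thesis by (rule Lim_transform_eventually[OF tendsto_const])
      qed simp
    qed
    show "integrable S (\<lambda>\<omega>. \<bar>X (\<omega> 0)\<bar> + Y (\<omega> 0))"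
      using integrable_coordinate[OF X, of 0] integrable_coordinate[OF Y, of 0] by auto
  qed (use Y0 in \<open>auto simp: indicator_def\<close>)
  then have "(\<integral>\<omega>. X (\<omega> 0) * indicator B \<omega> \<partial>S) \<le> 0"
    by (rule LIMSEQ_le_const2) (use int_le in blast)
  also have "(\<integral>\<omega>. X (\<omega> 0) * indicator B \<omega> \<partial>S) =
      (\<integral>s. (\<integral>\<omega>. X (case_nat s \<omega> 0) * indicator B (case_nat s \<omega>) \<partial>S) \<partial>M)"
    using integrable_mult_indicator[OF B integrable_coordinate[OF X, of 0]]
    by (intro integral_iter) (simp add: mult.commute)
  also have "\<dots> = (\<integral>s. (\<integral>\<omega>. X s * indicator B \<omega> \<partial>S) \<partial>M)"
    by (intro Bochner_Integration.integral_cong refl) (simp add: indicator_def B_shift)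
  also have "\<dots> = (\<integral>s. X s \<partial>M) * P.prob B"
    using sets.sets_into_space[OF B] by (simp add: Int_absorb2)
  finally have "P.prob B = 0"
    using drift by (metis measure_le_0_iff mult_le_0_iff not_less)
  then have "AE \<omega> in S. \<omega> \<notin> B"
    using B P.prob_eq_0 by blast
  then show ?thesis
    using AE_space
  proof eventually_elim
    case (elim \<omega>)
    then show ?case by (auto simp: B_def)
  qed
qed

section \<open>Measurability\<close>

lemma space_distr_space [simp]: "space distr_space = UNIV"
  by (simp add: distr_space_def)

lemma measurable_pmf_distr_space [measurable]: "(\<lambda>q. pmf q y) \<in> borel_measurable distr_space"
proof -
  have "pmf \<in> measurable distr_space (PiM UNIV (\<lambda>_. borel))"
    unfolding distr_space_def by (rule measurable_vimage_algebra1) (auto simp: space_PiM)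
  then show ?thesis by measurable
qed

lemma measurable_pmf_conv_power [measurable]:
  "(\<lambda>q. pmf (conv_power q z) j) \<in> borel_measurable distr_space"
proof (induction z arbitrary: j)
  case (Suc z)
  note [measurable] = Suc
  show ?case unfolding pmf_conv_power_Suc by measurable
qed simp

lemma measurable_log_mean [measurable]: "log_mean \<in> borel_measurable distr_space"
  unfolding log_mean_def[abs_def] offspring_mean_def by measurable

text \<open>
  A description by countably many conditions on the masses, without the existential quantifier over
  the parameters, from which measurability is evident.
\<close>

lemma linear_fractional_iff:
  "linear_fractional q \<longleftrightarrow> pmf q 0 < 1 \<and> 0 < pmf q 2 / pmf q 1 \<and> pmf q 2 / pmf q 1 < 1 \<and>
    (\<forall>k\<ge>1. pmf q k = (1 - pmf q 0) * (1 - pmf q 2 / pmf q 1) / (pmf q 2 / pmf q 1) * (pmf q 2 / pmf q 1) ^ k)"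
proof
  assume "linear_fractional q"
  then obtain a p where a: "0 \<le> a" "a < 1" and p: "0 < p" "p < 1" and q0: "pmf q 0 = a"
    and q: "\<forall>k\<ge>1. pmf q k = (1 - a) * (1 - p) / p * p ^ k"
    unfolding linear_fractional_def by blast
  have "pmf q 1 = (1 - a) * (1 - p)" "pmf q 2 = (1 - a) * (1 - p) * p"
    using q p by (auto simp: power2_eq_square)
  then have "pmf q 2 / pmf q 1 = p" using a p by simp
  then show "pmf q 0 < 1 \<and> 0 < pmf q 2 / pmf q 1 \<and> pmf q 2 / pmf q 1 < 1 \<and>
    (\<forall>k\<ge>1. pmf q k = (1 - pmf q 0) * (1 - pmf q 2 / pmf q 1) / (pmf q 2 / pmf q 1) * (pmf q 2 / pmf q 1) ^ k)"
    using a p q0 q by simp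
next
  assume "pmf q 0 < 1 \<and> 0 < pmf q 2 / pmf q 1 \<and> pmf q 2 / pmf q 1 < 1 \<and>
    (\<forall>k\<ge>1. pmf q k = (1 - pmf q 0) * (1 - pmf q 2 / pmf q 1) / (pmf q 2 / pmf q 1) * (pmf q 2 / pmf q 1) ^ k)"
  then show "linear_fractional q"
    unfolding linear_fractional_def using pmf_nonneg[of q 0] by blast
qed

lemma pred_linear_fractional [measurable]: "Measurable.pred distr_space linear_fractional"
  unfolding linear_fractional_iff[abs_def] by measurable

lemma measurable_pmf_gen_law [measurable]:
  "(\<lambda>\<pi>. pmf (gen_law \<pi> z n) j) \<in> borel_measurable env_space"
proof (induction n arbitrary: j)
  case (Suc n)
  note [measurable] = Suc
  have "ennreal (pmf (gen_law \<pi> z (Suc n)) j) =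
      (\<Sum>i. ennreal (pmf (gen_law \<pi> z n) i) * ennreal (pmf (conv_power (\<pi> n) i) j))" for \<pi>
    by (simp add: ennreal_pmf_bind nn_integral_measure_pmf nn_integral_count_space_nat)
  then have eq: "pmf (gen_law \<pi> z (Suc n)) j =
      enn2real (\<Sum>i. ennreal (pmf (gen_law \<pi> z n) i) * ennreal (pmf (conv_power (\<pi> n) i) j))" for \<pi>
    by (metis enn2real_ennreal pmf_nonneg)
  show ?case unfolding eq by measurable
qed simp

lemma gen_law_cong:
  "(\<And>i. i < n \<Longrightarrow> \<pi> i = \<pi>' i) \<Longrightarrow> gen_law \<pi> z n = gen_law \<pi>' z n"
  by (induction n) auto

section \<open>The tilted environment\<close>

lemma env_walk_cong:
  "(\<And>i. i < n \<Longrightarrow> \<pi> i = \<pi>' i) \<Longrightarrow> env_walk \<pi> n = env_walk \<pi>' n"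
  by (simp add: env_walk_def)

lemma measurable_env_walk [measurable]: "(\<lambda>\<pi>. env_walk \<pi> n) \<in> borel_measurable env_space"
  unfolding env_walk_def by measurable

lemma measurable_survival_prob [measurable]: "survival_prob \<in> borel_measurable env_space"
  by (rule borel_measurable_LIMSEQ_real[OF survival_prob_limit]) measurable

lemma survival_prob_bounds: "0 \<le> survival_prob \<pi>" "survival_prob \<pi> \<le> 1"
proof -
  show "0 \<le> survival_prob \<pi>" by (simp add: survival_prob_def)
  show "survival_prob \<pi> \<le> 1"
    unfolding survival_prob_def by (intro prob_space.prob_le_1 prob_space_quenched_law)
qed

abbreviation quenched_survival :: "(nat \<Rightarrow> nat pmf) \<Rightarrow> nat \<Rightarrow> real" where
  "quenched_survival \<pi> n \<equiv> 1 - pmf (gen_law \<pi> 1 n) 0"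

text \<open>
  The lower bound says that the terms \<open>exp (- S k) / (1 - q(0))\<close> with \<open>q = \<pi> k\<close> are dominated by a
  geometric sequence. They dominate in turn the summands of \<open>inv_survival\<close>, whose partial sums are
  therefore bounded.
\<close>

lemma env_walk_drift_survival:
  assumes lf: "\<And>k. linear_fractional (\<pi> k)" and \<delta>: "0 < \<delta>"
    and lower: "\<And>k. c + \<delta> * real k \<le> env_walk \<pi> k + ln (1 - pmf (\<pi> k) 0)"
  shows "(\<lambda>n. exp (- env_walk \<pi> n)) \<longlonglongrightarrow> 0" and "0 < survival_prob \<pi>"
proof -
  have a: "0 < 1 - pmf (\<pi> k) 0" for k
    using linear_fractional_lin_frac_gf(2)[OF lf[of k]] by simp
  have pen: "exp (- env_walk \<pi> k) * (1 / (1 - pmf (\<pi> k) 0)) \<le> exp (- c) * exp (- \<delta>) ^ k" for k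
  proof -
    have "1 / (1 - pmf (\<pi> k) 0) = exp (- ln (1 - pmf (\<pi> k) 0))"
      using a[of k] by (simp add: exp_minus inverse_eq_divide)
    then have "exp (- env_walk \<pi> k) * (1 / (1 - pmf (\<pi> k) 0)) = exp (- (env_walk \<pi> k + ln (1 - pmf (\<pi> k) 0)))"
      by (simp only: minus_add_distrib exp_add)
    also have "\<dots> \<le> exp (- (c + \<delta> * real k))"
      using lower[of k] by simp
    also have "\<dots> = exp (- c + (- \<delta>) * real k)" by simp
    also have "\<dots> = exp (- c) * exp (- \<delta>) ^ k"
      by (simp only: exp_add exp_of_nat2_mult)
    finally show ?thesis .
  qed
  have walk: "exp (- env_walk \<pi> k) \<le> exp (- c) * exp (- \<delta>) ^ k" for k
  proof -
    have "exp (- env_walk \<pi> k) * 1 \<le> exp (- env_walk \<pi> k) * (1 / (1 - pmf (\<pi> k) 0))"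
      using a[of k] by (intro mult_left_mono) auto
    then show ?thesis using pen[of k] by simp
  qed
  have r: "\<bar>exp (- \<delta>)\<bar> < 1" using \<delta> by simp
  have "(\<lambda>n. exp (- \<delta>) ^ n) \<longlonglongrightarrow> 0"
    by (rule LIMSEQ_power_zero) (use r in simp)
  then have upper: "(\<lambda>n. exp (- c) * exp (- \<delta>) ^ n) \<longlonglongrightarrow> 0"
    by (rule tendsto_mult_right_zero)
  show "(\<lambda>n. exp (- env_walk \<pi> n)) \<longlonglongrightarrow> 0"
    by (rule tendsto_sandwich[OF _ _ tendsto_const upper]) (simp_all add: walk)
  \<comment> \<open>the value of the dominating geometric series, plus the initial \<open>1\<close>\<close>
  define K where "K = 1 + exp (- c) * (1 / (1 - exp (- \<delta>)))"
  have sums: "(\<lambda>n. exp (- c) * exp (- \<delta>) ^ n) sums (exp (- c) * (1 / (1 - exp (- \<delta>))))"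
    using r by (intro sums_mult geometric_sums) simp
  have "inv_survival \<pi> n \<le> K" for n
  proof -
    have "inv_survival \<pi> n \<le> 1 + (\<Sum>k<n. exp (- c) * exp (- \<delta>) ^ k)"
      unfolding inv_survival_def
    proof (intro add_left_mono sum_mono)
      fix k
      have "exp (- env_walk \<pi> k) * (1 / (1 - pmf (\<pi> k) 0) - 1) \<le>
          exp (- env_walk \<pi> k) * (1 / (1 - pmf (\<pi> k) 0))"
        by (intro mult_left_mono) auto
      then show "exp (- env_walk \<pi> k) * (1 / (1 - pmf (\<pi> k) 0) - 1) \<le> exp (- c) * exp (- \<delta>) ^ k"
        using pen[of k] by linarith
    qed
    also have "(\<Sum>k<n. exp (- c) * exp (- \<delta>) ^ k) \<le> (\<Sum>k. exp (- c) * exp (- \<delta>) ^ k)"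
      using sums by (intro sum_le_suminf) (auto simp: sums_iff)
    finally show ?thesis using sums by (simp add: K_def sums_iff)
  qed
  then have "1 / K \<le> quenched_survival \<pi> n" for n
    using pmf_gen_law_linear_fractional(1,4)[of \<pi> n, OF lf] by (simp add: frac_le)
  then have "1 / K \<le> survival_prob \<pi>"
    using survival_prob_limit[of \<pi>] by (intro LIMSEQ_le_const) auto
  moreover have "0 < K" using r by (auto simp: K_def intro!: add_pos_nonneg)
  ultimately show "0 < survival_prob \<pi>" by (meson divide_pos_pos less_le_trans zero_less_one)
qed

text \<open>
  The tilted random walk is determined by the law \<open>\<mu>\<close> of a single random offspring distribution, so
  it is studied without reference to the branching process.
\<close>

locale tilted_environment =
  fixes \<mu> :: "nat pmf measure"
  assumes prob_\<mu>: "prob_space \<mu>"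
    and sets_\<mu>: "sets \<mu> = sets distr_space"
    and lin_frac: "AE q in \<mu>. linear_fractional q"
    and int_XexpX: "integrable \<mu> (\<lambda>q. log_mean q * exp (- log_mean q))"
    and XexpX_pos: "0 < (\<integral>q. log_mean q * exp (- log_mean q) \<partial>\<mu>)"
    and int_log: "integrable (tilted_law \<mu>) (\<lambda>q. ln (1 - pmf q 0))"
begin

definition \<gamma> :: real where "\<gamma> = (\<integral>q. exp (- log_mean q) \<partial>\<mu>)"

definition tilt :: "nat pmf \<Rightarrow> ennreal" where "tilt q = ennreal (exp (- log_mean q) / \<gamma>)"

abbreviation \<nu> :: "nat pmf measure" where "\<nu> \<equiv> tilted_law \<mu>"
abbreviation env\<^sub>\<mu> :: "(nat \<Rightarrow> nat pmf) measure" where "env\<^sub>\<mu> \<equiv> PiM UNIV (\<lambda>_. \<mu>)"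
abbreviation env\<^sub>\<nu> :: "(nat \<Rightarrow> nat pmf) measure" where "env\<^sub>\<nu> \<equiv> PiM UNIV (\<lambda>_. \<nu>)"

lemma measurable_\<mu> [measurable_cong]: "sets \<mu> = sets distr_space"
  by (rule sets_\<mu>)

lemma tilted_law_eq: "\<nu> = density \<mu> tilt"
  by (simp add: tilted_law_def tilt_def[abs_def] \<gamma>_def)

lemma sets_\<nu> [measurable_cong]: "sets \<nu> = sets distr_space"
  by (simp add: tilted_law_eq sets_\<mu>)

lemma measurable_tilt [measurable]: "tilt \<in> borel_measurable \<mu>"
  unfolding tilt_def[abs_def] by measurable

sublocale \<mu>: prob_space \<mu> by (rule prob_\<mu>)

text \<open>
  Where \<open>\<bar>x\<bar> \<ge> 1\<close>, the function \<open>exp (- x)\<close> is dominated by \<open>\<bar>x * exp (- x)\<bar>\<close>; elsewhere it is at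
  most \<open>exp 1\<close>.
\<close>

lemma integrable_exp_minus_log_mean: "integrable \<mu> (\<lambda>q. exp (- log_mean q))"
proof (rule Bochner_Integration.integrable_bound)
  show "integrable \<mu> (\<lambda>q. \<bar>log_mean q * exp (- log_mean q)\<bar> + exp 1)"
    using int_XexpX by simp
  have "exp (- x) \<le> \<bar>x * exp (- x)\<bar> + exp 1" for x :: real
  proof (cases "\<bar>x\<bar> \<le> 1")
    case True
    then have "exp (- x) \<le> exp 1" by simp
    then show ?thesis by (simp add: add_increasing)
  next
    case False
    then have "1 * exp (- x) \<le> \<bar>x\<bar> * exp (- x)" by (intro mult_right_mono) auto
    then show ?thesis by (simp add: abs_mult add_increasing2)
  qed
  then show "AE q in \<mu>. norm (exp (- log_mean q)) \<le> norm (\<bar>log_mean q * exp (- log_mean q)\<bar> + exp 1)"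
    by (simp add: add_nonneg_nonneg)
qed measurable

lemma \<gamma>_pos: "0 < \<gamma>"
proof -
  have "\<gamma> \<noteq> 0"
  proof
    assume "\<gamma> = 0"
    then have "AE q in \<mu>. exp (- log_mean q) = 0"
      using integral_nonneg_eq_0_iff_AE[OF integrable_exp_minus_log_mean] by (simp add: \<gamma>_def)
    then show False by simp
  qed
  moreover have "0 \<le> \<gamma>" unfolding \<gamma>_def by simp
  ultimately show ?thesis by simp
qed

lemma nn_integral_tilt: "(\<integral>\<^sup>+q. tilt q \<partial>\<mu>) = 1"
  unfolding tilt_def using integrable_exp_minus_log_mean \<gamma>_pos
  by (subst nn_integral_eq_integral) (auto simp: \<gamma>_def)

lemma prob_\<nu>: "prob_space \<nu>"
  by (rule prob_spaceI) (simp add: tilted_law_eq emeasure_density nn_integral_tilt cong: nn_integral_cong)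

sublocale \<nu>: prob_space \<nu> by (rule prob_\<nu>)
sublocale seq\<mu>: sequence_space \<mu> by unfold_locales
sublocale seq\<nu>: sequence_space \<nu> by unfold_locales

lemma AE_\<nu>_linear_fractional: "AE q in \<nu>. linear_fractional q"
  unfolding tilted_law_eq using lin_frac by (subst AE_density) auto

lemma AE_env_linear_fractional:
  "AE \<pi> in env\<^sub>\<mu>. \<forall>k. linear_fractional (\<pi> k)" "AE \<pi> in env\<^sub>\<nu>. \<forall>k. linear_fractional (\<pi> k)"
  unfolding AE_all_countable
  using AE_PiM_component[OF prob_\<mu> UNIV_I lin_frac] AE_PiM_component[OF prob_\<nu> UNIV_I AE_\<nu>_linear_fractional]
  by auto

lemma integrable_\<nu>_log_mean: "integrable \<nu> log_mean" and \<nu>_log_mean_pos: "0 < (\<integral>q. log_mean q \<partial>\<nu>)"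
proof -
  have m: "(\<lambda>q. exp (- log_mean q) / \<gamma>) \<in> borel_measurable \<mu>" "log_mean \<in> borel_measurable \<mu>" by measurable
  have nn: "AE q in \<mu>. 0 \<le> exp (- log_mean q) / \<gamma>" using \<gamma>_pos by simp
  show "integrable \<nu> log_mean"
    unfolding tilted_law_eq tilt_def using int_XexpX
    by (subst integrable_density[OF m(2,1) nn]) (simp add: mult.commute)
  have "(\<integral>q. log_mean q \<partial>\<nu>) = (\<integral>q. log_mean q * exp (- log_mean q) \<partial>\<mu>) / \<gamma>"
    unfolding tilted_law_eq tilt_def
    by (subst integral_density[OF m(2,1) nn]) (simp add: mult.commute)
  then show "0 < (\<integral>q. log_mean q \<partial>\<nu>)" using XexpX_pos \<gamma>_pos by simp
qed

text \<open>
  The boundedness of the penalised walk is applied to the steps \<open>log_mean q - \<delta>\<close>, with half of the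
  tilted mean taken away as \<open>\<delta>\<close>, and to the penalty \<open>- ln (1 - pmf q 0)\<close>.
\<close>

lemma AE_env_drift:
  "AE \<pi> in env\<^sub>\<nu>. (\<lambda>n. exp (- env_walk \<pi> n)) \<longlonglongrightarrow> 0 \<and> 0 < survival_prob \<pi>"
proof -
  define \<delta> where "\<delta> = (\<integral>q. log_mean q \<partial>\<nu>) / 2"
  have \<delta>: "0 < \<delta>" using \<nu>_log_mean_pos by (simp add: \<delta>_def)
  define Y where "Y q = - ln (1 - pmf q 0)" for q :: "nat pmf"
  have "AE \<pi> in env\<^sub>\<nu>. \<exists>c. \<forall>k. c \<le> (\<Sum>j<k. log_mean (\<pi> j) - \<delta>) - Y (\<pi> k)"
  proof (rule seq\<nu>.penalised_walk_bounded_below)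
    show "integrable \<nu> (\<lambda>q. log_mean q - \<delta>)" using integrable_\<nu>_log_mean by simp
    show "integrable \<nu> Y" unfolding Y_def using int_log by simp
    show "0 \<le> Y q" for q
      using pmf_le_1[of q 0] by (cases "pmf q 0 = 1") (auto simp: Y_def)
    have "(\<integral>q. log_mean q - \<delta> \<partial>\<nu>) = \<delta>"
      using integrable_\<nu>_log_mean by (simp add: \<delta>_def \<nu>.prob_space)
    then show "0 < (\<integral>q. log_mean q - \<delta> \<partial>\<nu>)" using \<delta> by simp
  qed
  then show ?thesis
    using AE_env_linear_fractional(2)
  proof eventually_elim
    case (elim \<pi>)
    obtain c where c: "\<And>k. c \<le> (\<Sum>j<k. log_mean (\<pi> j) - \<delta>) - Y (\<pi> k)" using elim(1) by blast
    have "c + \<delta> * real k \<le> env_walk \<pi> k + ln (1 - pmf (\<pi> k) 0)" for k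
      using c[of k] by (simp add: env_walk_def sum_subtractf Y_def mult.commute)
    then show ?case
      using env_walk_drift_survival[of \<pi> \<delta> c] elim(2) \<delta> by blast
  qed
qed

lemma sets_env\<^sub>\<nu> [measurable_cong]: "sets env\<^sub>\<nu> = sets env_space"
  by (auto intro!: sets_PiM_cong sets_\<nu>)

lemma sets_env\<^sub>\<mu> [measurable_cong]: "sets env\<^sub>\<mu> = sets env_space"
  by (auto intro!: sets_PiM_cong sets_\<mu>)

text \<open>
  The factor \<open>exp (- env_walk \<pi> n)\<close> is \<open>\<gamma> ^ n\<close> times the product of the tilting densities of the
  first \<open>n\<close> coordinates.
\<close>

lemma integral_tilt:
  fixes f :: "(nat \<Rightarrow> nat pmf) \<Rightarrow> real"
  assumes [measurable]: "f \<in> borel_measurable env_space"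
    and nn: "AE \<pi> in env\<^sub>\<mu>. 0 \<le> f \<pi>" "AE \<pi> in env\<^sub>\<nu>. 0 \<le> f \<pi>"
    and dep: "\<And>\<pi> \<pi>'. (\<And>i. i < n \<Longrightarrow> \<pi> i = \<pi>' i) \<Longrightarrow> f \<pi> = f \<pi>'"
  shows "(\<integral>\<pi>. exp (- env_walk \<pi> n) * f \<pi> \<partial>env\<^sub>\<mu>) = \<gamma> ^ n * (\<integral>\<pi>. f \<pi> \<partial>env\<^sub>\<nu>)"
proof -
  have prod: "(\<Prod>i<n. tilt (\<pi> i)) = ennreal (exp (- env_walk \<pi> n) / \<gamma> ^ n)" for \<pi>
    using \<gamma>_pos unfolding tilt_def
    by (subst prod_ennreal) (auto simp: prod_dividef env_walk_def exp_sum simp flip: sum_negf)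
  have "(\<integral>\<^sup>+\<pi>. ennreal (exp (- env_walk \<pi> n) / \<gamma> ^ n) * ennreal (f \<pi>) \<partial>env\<^sub>\<mu>) =
      (\<integral>\<^sup>+\<pi>. ennreal (f \<pi>) \<partial>env\<^sub>\<nu>)"
    unfolding prod[symmetric] tilted_law_eq
  proof (rule seq\<mu>.nn_integral_density_iid)
    show "ennreal (f \<pi>) = ennreal (f \<pi>')" if "\<And>i. i < n \<Longrightarrow> \<pi> i = \<pi>' i" for \<pi> \<pi>'
      using dep[OF that] by (simp only:)
  qed (use nn_integral_tilt in auto)
  also have "(\<integral>\<^sup>+\<pi>. ennreal (exp (- env_walk \<pi> n) / \<gamma> ^ n) * ennreal (f \<pi>) \<partial>env\<^sub>\<mu>) =
      (\<integral>\<^sup>+\<pi>. ennreal (exp (- env_walk \<pi> n) * f \<pi> / \<gamma> ^ n) \<partial>env\<^sub>\<mu>)"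
    using nn(1) \<gamma>_pos by (intro nn_integral_cong_AE) (auto simp flip: ennreal_mult)
  finally have "(\<integral>\<pi>. exp (- env_walk \<pi> n) * f \<pi> / \<gamma> ^ n \<partial>env\<^sub>\<mu>) = (\<integral>\<pi>. f \<pi> \<partial>env\<^sub>\<nu>)"
    using nn \<gamma>_pos by (subst (1 2) integral_eq_nn_integral) auto
  then show ?thesis using \<gamma>_pos by (simp add: field_simps)
qed

section \<open>Annealed probabilities as tilted expectations\<close>

lemma mass_factor_bounds:
  assumes "\<And>k. linear_fractional (\<pi> k)"
  shows "0 \<le> 1 - exp (- env_walk \<pi> n) * quenched_survival \<pi> n"
    "1 - exp (- env_walk \<pi> n) * quenched_survival \<pi> n \<le> 1"
  using pmf_gen_law_linear_fractional(3)[of \<pi> n, OF assms] by (auto simp: pmf_le_1)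

lemma annealed_mass_from_one:
  "(\<integral>\<pi>. pmf (gen_law \<pi> 1 n) (Suc j) \<partial>env\<^sub>\<mu>) =
    \<gamma> ^ n * (\<integral>\<pi>. (quenched_survival \<pi> n)\<^sup>2 * (1 - exp (- env_walk \<pi> n) * quenched_survival \<pi> n) ^ j \<partial>env\<^sub>\<nu>)"
    (is "?L = \<gamma> ^ n * (\<integral>\<pi>. ?f \<pi> \<partial>_)")
proof -
  have "AE \<pi> in env\<^sub>\<mu>. pmf (gen_law \<pi> 1 n) (Suc j) = exp (- env_walk \<pi> n) * ?f \<pi>"
    using AE_env_linear_fractional(1)
  proof eventually_elim
    case (elim \<pi>)
    then show ?case using pmf_gen_law_linear_fractional(2)[of \<pi> n j] by (simp only: mult.assoc)
  qed
  then have "?L = (\<integral>\<pi>. exp (- env_walk \<pi> n) * ?f \<pi> \<partial>env\<^sub>\<mu>)"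
    by (intro integral_cong_AE) measurable
  also have "\<dots> = \<gamma> ^ n * (\<integral>\<pi>. ?f \<pi> \<partial>env\<^sub>\<nu>)"
  proof (rule integral_tilt)
    have nn: "0 \<le> ?f \<pi>" if "\<forall>k. linear_fractional (\<pi> k)" for \<pi>
      using that by (intro mult_nonneg_nonneg zero_le_power2 zero_le_power mass_factor_bounds(1)) blast
    show "AE \<pi> in env\<^sub>\<mu>. 0 \<le> ?f \<pi>"
      using AE_env_linear_fractional(1) by (rule eventually_mono) (rule nn)
    show "AE \<pi> in env\<^sub>\<nu>. 0 \<le> ?f \<pi>"
      using AE_env_linear_fractional(2) by (rule eventually_mono) (rule nn)
    fix \<pi> \<pi>' :: "nat \<Rightarrow> nat pmf" assume eq: "\<And>i. i < n \<Longrightarrow> \<pi> i = \<pi>' i"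
    show "?f \<pi> = ?f \<pi>'"
      using gen_law_cong[of n \<pi> \<pi>' 1, OF eq] env_walk_cong[of n \<pi> \<pi>', OF eq] by simp
  qed measurable
  finally show ?thesis .
qed

text \<open>
  By the branching property exactly one of the \<open>Suc j\<close> lines of descent consists of one individual
  at time \<open>n\<close> and the other \<open>j\<close> are extinct; there are \<open>Suc j\<close> choices of that line.
\<close>

lemma annealed_mass_to_one:
  "(\<integral>\<pi>. pmf (gen_law \<pi> (Suc j) n) 1 \<partial>env\<^sub>\<mu>) =
    real (Suc j) * \<gamma> ^ n * (\<integral>\<pi>. (quenched_survival \<pi> n)\<^sup>2 * (1 - quenched_survival \<pi> n) ^ j \<partial>env\<^sub>\<nu>)"
    (is "?L = _ * _ * (\<integral>\<pi>. ?f \<pi> \<partial>_)")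
proof -
  have "AE \<pi> in env\<^sub>\<mu>. pmf (gen_law \<pi> (Suc j) n) 1 = exp (- env_walk \<pi> n) * (real (Suc j) * ?f \<pi>)"
    using AE_env_linear_fractional(1)
  proof eventually_elim
    case (elim \<pi>)
    have "pmf (gen_law \<pi> (Suc j) n) 1 = real (Suc j) * pmf (gen_law \<pi> 1 n) 0 ^ j * pmf (gen_law \<pi> 1 n) 1"
      by (simp only: gen_law_branching[of \<pi> "Suc j"] pmf_conv_power_1 diff_Suc_1)
    also have "pmf (gen_law \<pi> 1 n) 1 = exp (- env_walk \<pi> n) * (quenched_survival \<pi> n)\<^sup>2"
      using pmf_gen_law_linear_fractional(2)[of \<pi> n 0] elim by simp
    finally show ?case by simp
  qed
  then have "?L = (\<integral>\<pi>. exp (- env_walk \<pi> n) * (real (Suc j) * ?f \<pi>) \<partial>env\<^sub>\<mu>)"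
    by (intro integral_cong_AE) measurable
  also have "\<dots> = \<gamma> ^ n * (\<integral>\<pi>. real (Suc j) * ?f \<pi> \<partial>env\<^sub>\<nu>)"
  proof (rule integral_tilt)
    show "AE \<pi> in env\<^sub>\<mu>. 0 \<le> real (Suc j) * ?f \<pi>" "AE \<pi> in env\<^sub>\<nu>. 0 \<le> real (Suc j) * ?f \<pi>"
      by simp_all
    fix \<pi> \<pi>' :: "nat \<Rightarrow> nat pmf" assume eq: "\<And>i. i < n \<Longrightarrow> \<pi> i = \<pi>' i"
    show "real (Suc j) * ?f \<pi> = real (Suc j) * ?f \<pi>'"
      using gen_law_cong[of n \<pi> \<pi>' 1, OF eq] by simp
  qed measurable
  also have "(\<integral>\<pi>. real (Suc j) * ?f \<pi> \<partial>env\<^sub>\<nu>) = real (Suc j) * (\<integral>\<pi>. ?f \<pi> \<partial>env\<^sub>\<nu>)"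
    by (rule integral_mult_right_zero)
  finally show ?thesis by (simp only: mult_ac)
qed

text \<open>
  The dependence on \<open>j\<close> disappears in the limit: \<open>exp (- env_walk \<pi> n)\<close> tends to \<open>0\<close>, so the quenched
  mass function becomes flat on every finite set of positive sizes.
\<close>

lemma tilted_mass_from_one_limit:
  "(\<lambda>n. \<integral>\<pi>. (quenched_survival \<pi> n)\<^sup>2 * (1 - exp (- env_walk \<pi> n) * quenched_survival \<pi> n) ^ j \<partial>env\<^sub>\<nu>)
    \<longlonglongrightarrow> (\<integral>\<pi>. (survival_prob \<pi>)\<^sup>2 \<partial>env\<^sub>\<nu>)"
proof (rule integral_dominated_convergence[where w = "\<lambda>_. 1"])
  show "AE \<pi> in env\<^sub>\<nu>. (\<lambda>n. (quenched_survival \<pi> n)\<^sup>2 * (1 - exp (- env_walk \<pi> n) * quenched_survival \<pi> n) ^ j)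
      \<longlonglongrightarrow> (survival_prob \<pi>)\<^sup>2"
    using AE_env_drift
  proof eventually_elim
    case (elim \<pi>)
    have "(\<lambda>n. (quenched_survival \<pi> n)\<^sup>2 * (1 - exp (- env_walk \<pi> n) * quenched_survival \<pi> n) ^ j)
      \<longlonglongrightarrow> (survival_prob \<pi>)\<^sup>2 * (1 - 0 * survival_prob \<pi>) ^ j"
      using elim by (intro tendsto_intros survival_prob_limit) blast
    then show ?case by simp
  qed
  fix n
  show "AE \<pi> in env\<^sub>\<nu>. norm ((quenched_survival \<pi> n)\<^sup>2 *
      (1 - exp (- env_walk \<pi> n) * quenched_survival \<pi> n) ^ j) \<le> 1"
    using AE_env_linear_fractional(2)
  proof eventually_elim
    case (elim \<pi>)
    have b: "0 \<le> 1 - exp (- env_walk \<pi> n) * quenched_survival \<pi> n"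
      "1 - exp (- env_walk \<pi> n) * quenched_survival \<pi> n \<le> 1"
      by (rule mass_factor_bounds, use elim in blast)+
    have "(quenched_survival \<pi> n)\<^sup>2 * (1 - exp (- env_walk \<pi> n) * quenched_survival \<pi> n) ^ j \<le> 1 * 1"
      using b by (intro mult_mono power_le_one) (auto simp: pmf_le_1)
    moreover have "0 \<le> (quenched_survival \<pi> n)\<^sup>2 * (1 - exp (- env_walk \<pi> n) * quenched_survival \<pi> n) ^ j"
      using b by (intro mult_nonneg_nonneg zero_le_power) (auto simp: pmf_le_1)
    ultimately show ?case by (simp only: real_norm_def abs_of_nonneg mult_1)
  qed
  show "(\<lambda>\<pi>. (quenched_survival \<pi> n)\<^sup>2 *
      (1 - exp (- env_walk \<pi> n) * quenched_survival \<pi> n) ^ j) \<in> borel_measurable env\<^sub>\<nu>"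
    by measurable
next
  show "(\<lambda>\<pi>. (survival_prob \<pi>)\<^sup>2) \<in> borel_measurable env\<^sub>\<nu>"
    by measurable
qed simp

lemma tilted_mass_to_one_limit:
  "(\<lambda>n. \<integral>\<pi>. (quenched_survival \<pi> n)\<^sup>2 * (1 - quenched_survival \<pi> n) ^ j \<partial>env\<^sub>\<nu>)
    \<longlonglongrightarrow> (\<integral>\<pi>. (survival_prob \<pi>)\<^sup>2 * extinction_prob \<pi> ^ j \<partial>env\<^sub>\<nu>)"
proof (rule integral_dominated_convergence[where w = "\<lambda>_. 1"])
  show "AE \<pi> in env\<^sub>\<nu>. (\<lambda>n. (quenched_survival \<pi> n)\<^sup>2 * (1 - quenched_survival \<pi> n) ^ j)
      \<longlonglongrightarrow> (survival_prob \<pi>)\<^sup>2 * extinction_prob \<pi> ^ j"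
    unfolding extinction_prob_eq by (intro AE_I2 tendsto_intros survival_prob_limit)
  fix n
  have "(quenched_survival \<pi> n)\<^sup>2 * (1 - quenched_survival \<pi> n) ^ j \<le> 1 * 1" for \<pi>
    by (intro mult_mono power_le_one) (auto simp: pmf_le_1)
  then show "AE \<pi> in env\<^sub>\<nu>. norm ((quenched_survival \<pi> n)\<^sup>2 * (1 - quenched_survival \<pi> n) ^ j) \<le> 1"
    by (simp add: abs_mult)
  show "(\<lambda>\<pi>. (quenched_survival \<pi> n)\<^sup>2 * (1 - quenched_survival \<pi> n) ^ j) \<in> borel_measurable env\<^sub>\<nu>"
    by measurable
next
  show "(\<lambda>\<pi>. (survival_prob \<pi>)\<^sup>2 * extinction_prob \<pi> ^ j) \<in> borel_measurable env\<^sub>\<nu>"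
    unfolding extinction_prob_eq by measurable
qed simp

lemma survival_square_pos: "0 < (\<integral>\<pi>. (survival_prob \<pi>)\<^sup>2 \<partial>env\<^sub>\<nu>)"
proof -
  have int: "integrable env\<^sub>\<nu> (\<lambda>\<pi>. (survival_prob \<pi>)\<^sup>2)"
    by (rule seq\<nu>.P.integrable_const_bound[of _ 1])
       (auto intro!: power_le_one simp: survival_prob_bounds)
  have "(\<integral>\<pi>. (survival_prob \<pi>)\<^sup>2 \<partial>env\<^sub>\<nu>) \<noteq> 0"
  proof
    assume "(\<integral>\<pi>. (survival_prob \<pi>)\<^sup>2 \<partial>env\<^sub>\<nu>) = 0"
    then have "AE \<pi> in env\<^sub>\<nu>. (survival_prob \<pi>)\<^sup>2 = 0"
      using integral_nonneg_eq_0_iff_AE[OF int] by simp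
    then have "AE \<pi> in env\<^sub>\<nu>. False"
      using AE_env_drift by eventually_elim auto
    then show False by simp
  qed
  moreover have "0 \<le> (\<integral>\<pi>. (survival_prob \<pi>)\<^sup>2 \<partial>env\<^sub>\<nu>)" by simp
  ultimately show ?thesis by linarith
qed

definition limit_mass :: "nat \<Rightarrow> real" where
  "limit_mass z = real z * (\<integral>\<pi>. (survival_prob \<pi>)\<^sup>2 * extinction_prob \<pi> ^ (z - 1) \<partial>env\<^sub>\<nu>)"

lemma limit_mass_nonneg: "0 \<le> limit_mass z"
  unfolding limit_mass_def extinction_prob_eq
  by (intro mult_nonneg_nonneg integral_nonneg) (auto simp: survival_prob_bounds)

text \<open>
  Under the expectation stands the sum over \<open>j\<close> of \<open>(j + 1) * s\<^sup>2 * (1 - s) ^ j\<close>, which equals \<open>1\<close>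
  when the survival probability \<open>s\<close> is positive. If \<open>s = 0\<close> every term vanishes, so the almost
  sure positivity of \<open>s\<close> is what prevents a loss of mass.
\<close>

lemma nn_integral_limit_mass: "(\<integral>\<^sup>+z. ennreal (limit_mass z) \<partial>count_space UNIV) = 1"
proof -
  let ?f = "\<lambda>j \<pi>. real (Suc j) * ((survival_prob \<pi>)\<^sup>2 * (1 - survival_prob \<pi>) ^ j)"
  have nn: "0 \<le> ?f j \<pi>" for j \<pi>
    by (auto simp: survival_prob_bounds)
  have int: "integrable env\<^sub>\<nu> (\<lambda>\<pi>. (survival_prob \<pi>)\<^sup>2 * (1 - survival_prob \<pi>) ^ j)" for j
  proof (rule seq\<nu>.P.integrable_const_bound[of _ 1])
    have "(survival_prob \<pi>)\<^sup>2 * (1 - survival_prob \<pi>) ^ j \<le> 1 * 1" for \<pi>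
      by (intro mult_mono power_le_one) (auto simp: survival_prob_bounds)
    then show "AE \<pi> in env\<^sub>\<nu>. norm ((survival_prob \<pi>)\<^sup>2 * (1 - survival_prob \<pi>) ^ j) \<le> 1"
      by (simp add: abs_mult survival_prob_bounds)
  qed measurable
  have mass: "ennreal (limit_mass (Suc j)) = (\<integral>\<^sup>+\<pi>. ennreal (?f j \<pi>) \<partial>env\<^sub>\<nu>)" for j
  proof -
    have "(\<integral>\<^sup>+\<pi>. ennreal (?f j \<pi>) \<partial>env\<^sub>\<nu>) = ennreal (\<integral>\<pi>. ?f j \<pi> \<partial>env\<^sub>\<nu>)"
      using int[of j] nn[of j] by (intro nn_integral_eq_integral) auto
    then show ?thesis
      by (simp only: limit_mass_def extinction_prob_eq diff_Suc_1 integral_mult_right_zero)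
  qed
  have "(\<integral>\<^sup>+z. ennreal (limit_mass z) \<partial>count_space UNIV) = (\<Sum>z. ennreal (limit_mass z))"
    by (rule nn_integral_count_space_nat)
  also have "\<dots> = (\<Sum>j. ennreal (limit_mass (Suc j)))"
    using suminf_offset[of "\<lambda>z. ennreal (limit_mass z)" 1] by (simp add: limit_mass_def)
  also have "\<dots> = (\<integral>\<^sup>+\<pi>. (\<Sum>j. ennreal (?f j \<pi>)) \<partial>env\<^sub>\<nu>)"
    unfolding mass by (intro nn_integral_suminf[symmetric]) measurable
  also have "\<dots> = (\<integral>\<^sup>+\<pi>. 1 \<partial>env\<^sub>\<nu>)"
  proof (rule nn_integral_cong_AE)
    show "AE \<pi> in env\<^sub>\<nu>. (\<Sum>j. ennreal (?f j \<pi>)) = 1"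
      using AE_env_drift
    proof eventually_elim
      case (elim \<pi>)
      define s where "s = survival_prob \<pi>"
      have s: "0 < s" "s \<le> 1" using elim by (auto simp: s_def survival_prob_bounds)
      have "(\<lambda>j. s\<^sup>2 * (real (Suc j) * (1 - s) ^ j)) sums (s\<^sup>2 * (1 / (1 - (1 - s))\<^sup>2))"
        using s by (intro sums_mult geometric_deriv_sums) auto
      then have "(\<lambda>j. ?f j \<pi>) sums 1"
        using s by (simp add: s_def[symmetric] mult_ac)
      then show ?case
        by (simp only: suminf_ennreal_eq[OF nn] ennreal_1)
    qed
  qed
  also have "\<dots> = 1" by (simp add: seq\<nu>.P.emeasure_space_1)
  finally show ?thesis .
qed

end

section \<open>The annealed Markov property\<close>

context branching_process_re
begin

abbreviation env :: "'w \<Rightarrow> nat \<Rightarrow> nat pmf" where "env \<omega> \<equiv> \<lambda>k. Q k \<omega>"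

lemma measurable_env [measurable]: "env \<in> measurable M env_space"
  by (rule measurable_PiM_single') (use Q_measurable in auto)

lemma measurable_Z [measurable]: "Z n \<in> measurable M (count_space UNIV)"
  by (rule Z_measurable)

lemma distr_env: "distr M env_space env = PiM UNIV (\<lambda>_. distr M distr_space (Q 0))"
proof -
  have "distr M env_space env = PiM UNIV (\<lambda>i. distr M distr_space (Q i))"
    using indep_vars_iff_distr_eq_PiM[of UNIV Q "\<lambda>_. distr_space"] Q_measurable Q_indep
    by (simp add: restrict_def)
  also have "(\<lambda>i. distr M distr_space (Q i)) = (\<lambda>_. distr M distr_space (Q 0))"
    using Q_ident by (rule ext)
  finally show ?thesis .
qed

text \<open>
  One step of the chain, weighted by a bounded functional \<open>g\<close> of the whole environment. Keeping \<open>g\<close>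
  general is what makes the iteration in \<open>chain_steps\<close> possible: after each step the transition
  probability is itself a functional of the environment and is absorbed into \<open>g\<close>.
\<close>

lemma chain_step:
  fixes g :: "(nat \<Rightarrow> nat pmf) \<Rightarrow> real"
  assumes g [measurable]: "g \<in> borel_measurable env_space" and g01: "\<And>\<pi>. 0 \<le> g \<pi>" "\<And>\<pi>. g \<pi> \<le> 1"
    and mn: "m \<le> n"
  shows "(\<integral>\<^sup>+\<omega>. ennreal (g (env \<omega>)) * indicator {\<omega>. Z m \<omega> = z \<and> Z n \<omega> = i \<and> Z (Suc n) \<omega> = j} \<omega> \<partial>M) =
    (\<integral>\<^sup>+\<omega>. ennreal (g (env \<omega>) * pmf (conv_power (Q n \<omega>) i) j) *
      indicator {\<omega>. Z m \<omega> = z \<and> Z n \<omega> = i} \<omega> \<partial>M)"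
proof -
  define N where "N = env_space \<Otimes>\<^sub>M PiM {..n} (\<lambda>_. count_space (UNIV :: nat set))"
  define past where "past = (\<lambda>\<omega>. (env \<omega>, \<lambda>k\<in>{..n}. Z k \<omega>))"
  define F where "F = vimage_algebra (space M) past N"
  have past: "past \<in> measurable M N"
    unfolding past_def N_def by measurable
  have "subalgebra M F"
    using past unfolding F_def subalgebra_def measurable_iff_sets by simp
  then interpret F: finite_measure_subalgebra M F
    by unfold_locales
  define h where "h = (\<lambda>(\<pi>, x). g \<pi> * (if x m = z \<and> x n = i then 1 else 0 :: real))"
  have comp: "(\<lambda>y. snd y k) \<in> measurable N (count_space UNIV)" if "k \<le> n" for k
    using that unfolding N_def by (intro measurable_compose[OF measurable_snd]) (simp add: measurable_component_singleton)
  have [measurable]: "(\<lambda>y. snd y m) \<in> measurable N (count_space UNIV)"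
    "(\<lambda>y. snd y n) \<in> measurable N (count_space UNIV)" "fst \<in> measurable N env_space"
    using mn comp unfolding N_def by auto
  have "h \<in> borel_measurable N"
    unfolding h_def case_prod_unfold by measurable
  moreover have "past \<in> measurable F N"
    unfolding F_def using past by (intro measurable_vimage_algebra1) (auto simp: measurable_def)
  ultimately have hF: "(\<lambda>\<omega>. h (past \<omega>)) \<in> borel_measurable F"
    by (rule measurable_compose[rotated])
  have hp: "h (past \<omega>) = g (env \<omega>) * indicator {\<omega>. Z m \<omega> = z \<and> Z n \<omega> = i} \<omega>" for \<omega>
    using mn by (simp add: h_def past_def)
  let ?J = "indicator {\<omega> \<in> space M. Z (Suc n) \<omega> = j} :: 'w \<Rightarrow> real"
  have int: "integrable M (\<lambda>\<omega>. h (past \<omega>) * ?J \<omega>)"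
    unfolding hp
    by (rule integrable_const_bound[of _ 1]) (auto simp: indicator_def g01 abs_of_nonneg)
  have J: "?J \<in> borel_measurable M" by measurable
  have "(\<integral>\<omega>. h (past \<omega>) * ?J \<omega> \<partial>M) = (\<integral>\<omega>. h (past \<omega>) * real_cond_exp M F ?J \<omega> \<partial>M)"
    by (rule F.real_cond_exp_intg(2)[OF int hF J, symmetric])
  also have "\<dots> = (\<integral>\<omega>. h (past \<omega>) * pmf (conv_power (Q n \<omega>) i) j \<partial>M)"
  proof (rule integral_cong_AE)
    have "AE \<omega> in M. real_cond_exp M F ?J \<omega> = pmf (conv_power (Q n \<omega>) (Z n \<omega>)) j"
      using Z_chain[of n j] unfolding F_def past_def N_def .
    then show "AE \<omega> in M. h (past \<omega>) * real_cond_exp M F ?J \<omega> = h (past \<omega>) * pmf (conv_power (Q n \<omega>) i) j"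
      by eventually_elim (auto simp: hp indicator_def)
  qed (unfold hp, measurable)
  finally have eq: "(\<integral>\<omega>. h (past \<omega>) * ?J \<omega> \<partial>M) = (\<integral>\<omega>. h (past \<omega>) * pmf (conv_power (Q n \<omega>) i) j \<partial>M)" .
  have "(\<integral>\<^sup>+\<omega>. ennreal (g (env \<omega>)) * indicator {\<omega>. Z m \<omega> = z \<and> Z n \<omega> = i \<and> Z (Suc n) \<omega> = j} \<omega> \<partial>M) =
      (\<integral>\<^sup>+\<omega>. ennreal (h (past \<omega>) * ?J \<omega>) \<partial>M)"
    by (intro nn_integral_cong) (auto simp: hp indicator_def)
  also have "\<dots> = ennreal (\<integral>\<omega>. h (past \<omega>) * ?J \<omega> \<partial>M)"
    by (rule nn_integral_eq_integral[OF int]) (auto simp: hp g01)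
  also have "\<dots> = (\<integral>\<^sup>+\<omega>. ennreal (h (past \<omega>) * pmf (conv_power (Q n \<omega>) i) j) \<partial>M)"
    unfolding eq
  proof (rule nn_integral_eq_integral[symmetric])
    have "g \<pi> * pmf q j \<le> 1 * 1" for \<pi> and q :: "nat pmf"
      by (intro mult_mono g01 pmf_le_1) auto
    then show "integrable M (\<lambda>\<omega>. h (past \<omega>) * pmf (conv_power (Q n \<omega>) i) j)"
      unfolding hp by (intro integrable_const_bound[of _ 1]) (auto simp: indicator_def g01)
  qed (auto simp: hp g01)
  also have "\<dots> = (\<integral>\<^sup>+\<omega>. ennreal (g (env \<omega>) * pmf (conv_power (Q n \<omega>) i) j) *
      indicator {\<omega>. Z m \<omega> = z \<and> Z n \<omega> = i} \<omega> \<partial>M)"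
    by (intro nn_integral_cong) (auto simp: hp indicator_def)
  finally show ?thesis .
qed

lemma chain_steps:
  fixes g :: "(nat \<Rightarrow> nat pmf) \<Rightarrow> real"
  assumes "g \<in> borel_measurable env_space" and "\<And>\<pi>. 0 \<le> g \<pi>" "\<And>\<pi>. g \<pi> \<le> 1"
  shows "(\<integral>\<^sup>+\<omega>. ennreal (g (env \<omega>)) * indicator {\<omega>. Z m \<omega> = z \<and> Z (m + k) \<omega> = j} \<omega> \<partial>M) =
    (\<integral>\<^sup>+\<omega>. ennreal (g (env \<omega>) * pmf (gen_law (\<lambda>l. Q (m + l) \<omega>) z k) j) *
      indicator {\<omega>. Z m \<omega> = z} \<omega> \<partial>M)"
  using assms
proof (induction k arbitrary: g j)
  case 0
  show ?case
    by (intro nn_integral_cong) (auto simp: indicator_def)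
next
  case (Suc k)
  note [measurable] = Suc.prems(1)
  have gc: "(\<lambda>\<pi>. g \<pi> * pmf (conv_power (\<pi> (m + k)) i) j) \<in> borel_measurable env_space" for i
    by measurable
  have gc01: "0 \<le> g \<pi> * pmf (conv_power (\<pi> (m + k)) i) j" "g \<pi> * pmf (conv_power (\<pi> (m + k)) i) j \<le> 1"
    for \<pi> i
    using Suc.prems(2,3)[of \<pi>] mult_mono[of "g \<pi>" 1 "pmf (conv_power (\<pi> (m + k)) i) j" 1]
    by (auto simp: pmf_le_1)
  have shift [measurable]: "(\<lambda>\<omega> l. Q (m + l) \<omega>) \<in> measurable M env_space"
    by (rule measurable_PiM_single') (use Q_measurable in auto)
  have "(\<integral>\<^sup>+\<omega>. ennreal (g (env \<omega>)) * indicator {\<omega>. Z m \<omega> = z \<and> Z (m + Suc k) \<omega> = j} \<omega> \<partial>M) =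
      (\<integral>\<^sup>+\<omega>. (\<Sum>i. ennreal (g (env \<omega>)) *
        indicator {\<omega>. Z m \<omega> = z \<and> Z (m + k) \<omega> = i \<and> Z (Suc (m + k)) \<omega> = j} \<omega>) \<partial>M)"
  proof (rule nn_integral_cong)
    fix \<omega>
    have "(\<Sum>i. ennreal (g (env \<omega>)) *
        indicator {\<omega>. Z m \<omega> = z \<and> Z (m + k) \<omega> = i \<and> Z (Suc (m + k)) \<omega> = j} \<omega>) =
      (\<Sum>i\<in>{Z (m + k) \<omega>}. ennreal (g (env \<omega>)) *
        indicator {\<omega>. Z m \<omega> = z \<and> Z (m + k) \<omega> = i \<and> Z (Suc (m + k)) \<omega> = j} \<omega>)"
      by (rule suminf_finite) auto
    then show "ennreal (g (env \<omega>)) * indicator {\<omega>. Z m \<omega> = z \<and> Z (m + Suc k) \<omega> = j} \<omega> =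
      (\<Sum>i. ennreal (g (env \<omega>)) *
        indicator {\<omega>. Z m \<omega> = z \<and> Z (m + k) \<omega> = i \<and> Z (Suc (m + k)) \<omega> = j} \<omega>)"
      by (simp add: indicator_def)
  qed
  also have "\<dots> = (\<Sum>i. \<integral>\<^sup>+\<omega>. ennreal (g (env \<omega>)) *
        indicator {\<omega>. Z m \<omega> = z \<and> Z (m + k) \<omega> = i \<and> Z (Suc (m + k)) \<omega> = j} \<omega> \<partial>M)"
    by (rule nn_integral_suminf) measurable
  also have "\<dots> = (\<Sum>i. \<integral>\<^sup>+\<omega>. ennreal (g (env \<omega>) * pmf (conv_power (Q (m + k) \<omega>) i) j) *
        indicator {\<omega>. Z m \<omega> = z \<and> Z (m + k) \<omega> = i} \<omega> \<partial>M)"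
    by (intro suminf_cong chain_step Suc.prems) simp
  also have "\<dots> = (\<Sum>i. \<integral>\<^sup>+\<omega>. ennreal (g (env \<omega>) * pmf (conv_power (Q (m + k) \<omega>) i) j *
        pmf (gen_law (\<lambda>l. Q (m + l) \<omega>) z k) i) * indicator {\<omega>. Z m \<omega> = z} \<omega> \<partial>M)"
    by (intro suminf_cong Suc.IH gc gc01)
  also have "\<dots> = (\<integral>\<^sup>+\<omega>. (\<Sum>i. ennreal (g (env \<omega>) * pmf (conv_power (Q (m + k) \<omega>) i) j *
        pmf (gen_law (\<lambda>l. Q (m + l) \<omega>) z k) i) * indicator {\<omega>. Z m \<omega> = z} \<omega>) \<partial>M)"
    by (rule nn_integral_suminf[symmetric]) measurable
  also have "\<dots> = (\<integral>\<^sup>+\<omega>. ennreal (g (env \<omega>) * pmf (gen_law (\<lambda>l. Q (m + l) \<omega>) z (Suc k)) j) *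
      indicator {\<omega>. Z m \<omega> = z} \<omega> \<partial>M)"
  proof (rule nn_integral_cong)
    fix \<omega>
    have "(\<Sum>i. ennreal (g (env \<omega>) * pmf (conv_power (Q (m + k) \<omega>) i) j * pmf (gen_law (\<lambda>l. Q (m + l) \<omega>) z k) i) *
          indicator {\<omega>. Z m \<omega> = z} \<omega>) =
        ennreal (g (env \<omega>)) * (\<Sum>i. ennreal (pmf (gen_law (\<lambda>l. Q (m + l) \<omega>) z k) i) *
          ennreal (pmf (conv_power (Q (m + k) \<omega>) i) j)) * indicator {\<omega>. Z m \<omega> = z} \<omega>"
      using Suc.prems(2) by (simp add: ennreal_mult mult_ac flip: ennreal_suminf_cmult ennreal_suminf_multc)
    also have "(\<Sum>i. ennreal (pmf (gen_law (\<lambda>l. Q (m + l) \<omega>) z k) i) *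
          ennreal (pmf (conv_power (Q (m + k) \<omega>) i) j)) = ennreal (pmf (gen_law (\<lambda>l. Q (m + l) \<omega>) z (Suc k)) j)"
      by (simp add: ennreal_pmf_bind nn_integral_measure_pmf nn_integral_count_space_nat)
    finally show "(\<Sum>i. ennreal (g (env \<omega>) * pmf (conv_power (Q (m + k) \<omega>) i) j * pmf (gen_law (\<lambda>l. Q (m + l) \<omega>) z k) i) *
          indicator {\<omega>. Z m \<omega> = z} \<omega>) =
        ennreal (g (env \<omega>) * pmf (gen_law (\<lambda>l. Q (m + l) \<omega>) z (Suc k)) j) * indicator {\<omega>. Z m \<omega> = z} \<omega>"
      using Suc.prems(2) by (simp add: ennreal_mult del: gen_law.simps)
  qed
  finally show ?case .
qed

text \<open>
  Given the environment, the probability is a product of two factors, the first a function of the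
  environment before time \<open>m\<close> and the second of the environment from time \<open>m\<close> on. These are
  independent, and the second has the same distribution as the environment from time \<open>0\<close> on.
\<close>

lemma annealed_two_point:
  assumes start: "AE \<omega> in M. Z 0 \<omega> = 1"
  defines "E \<equiv> PiM UNIV (\<lambda>_. distr M distr_space (Q 0))"
  shows "measure M {\<omega> \<in> space M. Z m \<omega> = z \<and> Z (m + k) \<omega> = j} =
    (\<integral>\<pi>. pmf (gen_law \<pi> 1 m) z \<partial>E) * (\<integral>\<pi>. pmf (gen_law \<pi> z k) j \<partial>E)"
proof -
  interpret D: prob_space "distr M distr_space (Q 0)"
    by (rule prob_space_distr) (rule Q_measurable)
  interpret D: sequence_space "distr M distr_space (Q 0)" by unfold_locales
  have [measurable_cong]: "sets E = sets env_space" unfolding E_def by (rule sets_PiM_cong) auto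
  have shift: "(\<lambda>\<pi> l. \<pi> (m + l)) \<in> measurable env_space env_space"
    by (rule measurable_PiM_single') auto
  define g where "g \<pi> = pmf (gen_law (\<lambda>l. \<pi> (m + l)) z k) j" for \<pi> :: "nat \<Rightarrow> nat pmf"
  have g [measurable]: "g \<in> borel_measurable env_space"
    unfolding g_def by (rule measurable_compose[OF shift measurable_pmf_gen_law])
  have h: "(\<lambda>\<pi>. ennreal (pmf (gen_law \<pi> 1 m) z) * ennreal (g \<pi>)) \<in> borel_measurable (distr M env_space env)"
    unfolding measurable_distr_eq1 by measurable
  have g_nonneg: "0 \<le> g \<pi>" for \<pi> by (simp add: g_def)
  have "emeasure M {\<omega> \<in> space M. Z m \<omega> = z \<and> Z (m + k) \<omega> = j} =
      (\<integral>\<^sup>+\<omega>. indicator {\<omega> \<in> space M. Z m \<omega> = z \<and> Z (m + k) \<omega> = j} \<omega> \<partial>M)"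
    by (rule nn_integral_indicator[symmetric]) measurable
  also have "\<dots> = (\<integral>\<^sup>+\<omega>. ennreal 1 * indicator {\<omega>. Z m \<omega> = z \<and> Z (m + k) \<omega> = j} \<omega> \<partial>M)"
    by (intro nn_integral_cong) (auto simp: indicator_def)
  also have "\<dots> = (\<integral>\<^sup>+\<omega>. ennreal (1 * g (env \<omega>)) * indicator {\<omega>. Z m \<omega> = z} \<omega> \<partial>M)"
    unfolding g_def by (rule chain_steps[where g = "\<lambda>_. 1"]) auto
  also have "\<dots> = (\<integral>\<^sup>+\<omega>. ennreal (g (env \<omega>)) * indicator {\<omega>. Z 0 \<omega> = 1 \<and> Z (0 + m) \<omega> = z} \<omega> \<partial>M)"
  proof (rule nn_integral_cong_AE)
    show "AE \<omega> in M. ennreal (1 * g (env \<omega>)) * indicator {\<omega>. Z m \<omega> = z} \<omega> =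
        ennreal (g (env \<omega>)) * indicator {\<omega>. Z 0 \<omega> = 1 \<and> Z (0 + m) \<omega> = z} \<omega>"
      using start by eventually_elim (simp add: indicator_def)
  qed
  also have "\<dots> = (\<integral>\<^sup>+\<omega>. ennreal (g (env \<omega>) * pmf (gen_law (\<lambda>l. Q (0 + l) \<omega>) 1 m) z) *
      indicator {\<omega>. Z 0 \<omega> = 1} \<omega> \<partial>M)"
    by (rule chain_steps[OF g]) (auto simp: g_def pmf_le_1)
  also have "\<dots> = (\<integral>\<^sup>+\<omega>. ennreal (pmf (gen_law (env \<omega>) 1 m) z) * ennreal (g (env \<omega>)) \<partial>M)"
  proof (rule nn_integral_cong_AE)
    show "AE \<omega> in M. ennreal (g (env \<omega>) * pmf (gen_law (\<lambda>l. Q (0 + l) \<omega>) 1 m) z) *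
        indicator {\<omega>. Z 0 \<omega> = 1} \<omega> = ennreal (pmf (gen_law (env \<omega>) 1 m) z) * ennreal (g (env \<omega>))"
      using start
    proof eventually_elim
      case (elim \<omega>)
      then show ?case
        by (simp add: indicator_def) (simp only: ennreal_mult[OF g_nonneg pmf_nonneg] mult.commute)
    qed
  qed
  also have "\<dots> = (\<integral>\<^sup>+\<pi>. ennreal (pmf (gen_law \<pi> 1 m) z) * ennreal (g \<pi>) \<partial>distr M env_space env)"
    by (rule nn_integral_distr[OF measurable_env h, symmetric])
  also have "\<dots> = (\<integral>\<^sup>+\<pi>. ennreal (pmf (gen_law \<pi> 1 m) z) * ennreal (g \<pi>) \<partial>E)"
    by (simp only: distr_env E_def)
  also have "\<dots> = (\<integral>\<^sup>+\<pi>. ennreal (pmf (gen_law \<pi> 1 m) z) \<partial>E) * (\<integral>\<^sup>+\<pi>. ennreal (pmf (gen_law \<pi> z k) j) \<partial>E)"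
    unfolding g_def
  proof (rule D.nn_integral_future_indep[folded E_def, where n = m and
        f = "\<lambda>\<pi>. ennreal (pmf (gen_law \<pi> 1 m) z)" and g = "\<lambda>\<pi>. ennreal (pmf (gen_law \<pi> z k) j)"])
    show "(\<lambda>\<pi>. ennreal (pmf (gen_law \<pi> 1 m) z)) \<in> borel_measurable E" by measurable
    show "(\<lambda>\<pi>. ennreal (pmf (gen_law \<pi> z k) j)) \<in> borel_measurable E" by measurable
    show "ennreal (pmf (gen_law \<pi> 1 m) z) = ennreal (pmf (gen_law \<pi>' 1 m) z)"
      if "\<And>i. i < m \<Longrightarrow> \<pi> i = \<pi>' i" for \<pi> \<pi>'
      using gen_law_cong[of m \<pi> \<pi>' 1, OF that] by (simp only:)
  qed
  finally have "measure M {\<omega> \<in> space M. Z m \<omega> = z \<and> Z (m + k) \<omega> = j} =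
      enn2real (\<integral>\<^sup>+\<pi>. ennreal (pmf (gen_law \<pi> 1 m) z) \<partial>E) * enn2real (\<integral>\<^sup>+\<pi>. ennreal (pmf (gen_law \<pi> z k) j) \<partial>E)"
    by (simp only: measure_def enn2real_mult)
  also have "enn2real (\<integral>\<^sup>+\<pi>. ennreal (pmf (gen_law \<pi> 1 m) z) \<partial>E) = (\<integral>\<pi>. pmf (gen_law \<pi> 1 m) z \<partial>E)"
    by (rule integral_eq_nn_integral[symmetric]) auto
  also have "enn2real (\<integral>\<^sup>+\<pi>. ennreal (pmf (gen_law \<pi> z k) j) \<partial>E) = (\<integral>\<pi>. pmf (gen_law \<pi> z k) j \<partial>E)"
    by (rule integral_eq_nn_integral[symmetric]) auto
  finally show ?thesis .
qed

end

section \<open>The conditional limit law\<close>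

lemma filterlim_time_fraction:
  fixes t :: real
  assumes "0 < t" "t < 1"
  shows "filterlim (\<lambda>n. nat \<lfloor>real n * t\<rfloor>) at_top at_top"
    and "filterlim (\<lambda>n. n - nat \<lfloor>real n * t\<rfloor>) at_top at_top"
    and "nat \<lfloor>real n * t\<rfloor> \<le> n"
proof -
  have le: "real (nat \<lfloor>real n * t\<rfloor>) \<le> real n * t" for n
    using assms by (simp add: of_nat_nat)
  have le': "nat \<lfloor>real n * t\<rfloor> \<le> n" for n
  proof -
    have "real n * t \<le> real n * 1" using assms by (intro mult_left_mono) auto
    then show ?thesis using le[of n] by linarith
  qed
  then show "nat \<lfloor>real n * t\<rfloor> \<le> n" .
  have large: "eventually (\<lambda>n. real C \<le> real n * u) sequentially" if "0 < u" for C :: nat and u :: real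
  proof (rule eventually_sequentiallyI)
    fix n assume "nat \<lceil>real C / u\<rceil> \<le> n"
    then have "real C / u \<le> real n" by linarith
    then show "real C \<le> real n * u" using that by (simp add: pos_divide_le_eq)
  qed
  show "filterlim (\<lambda>n. nat \<lfloor>real n * t\<rfloor>) at_top at_top"
    unfolding filterlim_at_top
  proof
    fix C
    show "eventually (\<lambda>n. C \<le> nat \<lfloor>real n * t\<rfloor>) sequentially"
      using large[OF assms(1), of C] by eventually_elim (rule le_nat_floor)
  qed
  show "filterlim (\<lambda>n. n - nat \<lfloor>real n * t\<rfloor>) at_top at_top"
    unfolding filterlim_at_top
  proof
    fix C
    have "0 < 1 - t" using assms by simp
    from large[OF this, of C] show "eventually (\<lambda>n. C \<le> n - nat \<lfloor>real n * t\<rfloor>) sequentially"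
    proof eventually_elim
      case (elim n)
      have "real C \<le> real n - real (nat \<lfloor>real n * t\<rfloor>)"
        using elim le[of n] by (simp add: algebra_simps)
      also have "\<dots> = real (n - nat \<lfloor>real n * t\<rfloor>)" using le'[of n] by (simp add: of_nat_diff)
      finally show ?case by simp
    qed
  qed
qed

theorem theorem2p1p3:
  fixes M :: "'w measure" and Q :: "nat \<Rightarrow> 'w \<Rightarrow> nat pmf" and Z :: "nat \<Rightarrow> 'w \<Rightarrow> nat"
  assumes bpre: "branching_process_re M Q Z"
    and start: "AE \<omega> in M. Z 0 \<omega> = 1"
    and lin_frac: "AE \<omega> in M. linear_fractional (Q 0 \<omega>)"
    \<comment> \<open>\<open>E[X] > 0\<close> in the extended sense (\<open>X = log_mean (Q 0)\<close>), \<open>E[X] = \<infinity>\<close> allowed: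
       \<open>E[X\<^sup>-] < E[X\<^sup>+]\<close>\<close>
    and supercritical: "(\<integral>\<^sup>+\<omega>. ennreal (- log_mean (Q 0 \<omega>)) \<partial>M) < (\<integral>\<^sup>+\<omega>. ennreal (log_mean (Q 0 \<omega>)) \<partial>M)"
    and XexpX_integrable: "integrable M (\<lambda>\<omega>. log_mean (Q 0 \<omega>) * exp (- log_mean (Q 0 \<omega>)))"
    and XexpX_pos: "0 < (\<integral>\<omega>. log_mean (Q 0 \<omega>) * exp (- log_mean (Q 0 \<omega>)) \<partial>M)"
    \<comment> \<open>the integrand is nonpositive, so integrability says that its expectation exceeds \<open>-\<infinity>\<close>\<close>
    and log_integrable: "integrable (tilted_law (distr M distr_space (Q 0))) (\<lambda>q. ln (1 - pmf q 0))"
  shows "\<exists>r :: nat pmf. set_pmf r \<subseteq> {1..} \<and>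
    (\<forall>t::real. 0 < t \<longrightarrow> t < 1 \<longrightarrow> (\<forall>z\<ge>1.
       (\<lambda>n. \<P>(\<omega> in M. Z (nat \<lfloor>real n * t\<rfloor>) \<omega> = z \<bar> Z n \<omega> = 1)) \<longlonglongrightarrow> pmf r z)) \<and>
    (\<forall>z\<ge>1. pmf r z = real z *
       (\<integral>\<pi>. (survival_prob \<pi>)\<^sup>2 * extinction_prob \<pi> ^ (z - 1) \<partial>PiM UNIV (\<lambda>_. tilted_law (distr M distr_space (Q 0)))))"
proof -
  interpret branching_process_re M Q Z by (rule bpre)
  define \<mu> where "\<mu> = distr M distr_space (Q 0)"
  have Q0: "Q 0 \<in> measurable M distr_space" by (rule Q_measurable)
  have m: "(\<lambda>q. log_mean q * exp (- log_mean q)) \<in> borel_measurable distr_space" by measurable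
  interpret T: tilted_environment \<mu>
  proof (rule tilted_environment.intro)
    show "prob_space \<mu>" unfolding \<mu>_def by (rule prob_space_distr[OF Q0])
    show "sets \<mu> = sets distr_space" by (simp add: \<mu>_def)
    have lf: "{q \<in> space distr_space. linear_fractional q} \<in> sets distr_space"
      using pred_linear_fractional by (rule predE)
    show "AE q in \<mu>. linear_fractional q"
      unfolding \<mu>_def using lin_frac by (subst AE_distr_iff[OF Q0 lf])
    show "integrable \<mu> (\<lambda>q. log_mean q * exp (- log_mean q))"
      unfolding \<mu>_def using XexpX_integrable by (subst integrable_distr_eq[OF Q0 m])
    show "0 < (\<integral>q. log_mean q * exp (- log_mean q) \<partial>\<mu>)"
      unfolding \<mu>_def using XexpX_pos by (subst integral_distr[OF Q0 m])
    show "integrable (tilted_law \<mu>) (\<lambda>q. ln (1 - pmf q 0))"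
      unfolding \<mu>_def by (rule log_integrable)
  qed
  define r where "r = embed_pmf T.limit_mass"
  have r: "pmf r z = T.limit_mass z" for z
    unfolding r_def by (rule pmf_embed_pmf[OF T.limit_mass_nonneg T.nn_integral_limit_mass])
  define a where "a j n = (\<integral>\<pi>. (quenched_survival \<pi> n)\<^sup>2 *
      (1 - exp (- env_walk \<pi> n) * quenched_survival \<pi> n) ^ j \<partial>T.env\<^sub>\<nu>)" for j n
  define b where "b j n = (\<integral>\<pi>. (quenched_survival \<pi> n)\<^sup>2 * (1 - quenched_survival \<pi> n) ^ j \<partial>T.env\<^sub>\<nu>)" for j n
  define s where "s = (\<integral>\<pi>. (survival_prob \<pi>)\<^sup>2 \<partial>T.env\<^sub>\<nu>)"
  have two: "measure M {\<omega> \<in> space M. Z m \<omega> = Suc j \<and> Z (m + k) \<omega> = 1} =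
      T.\<gamma> ^ m * a j m * (real (Suc j) * T.\<gamma> ^ k * b j k)" for j m k
    unfolding annealed_two_point[OF start] \<mu>_def[symmetric] a_def b_def
    by (simp only: T.annealed_mass_from_one T.annealed_mass_to_one)
  \<comment> \<open>the case of an empty second stage: \<open>m = n\<close> and \<open>k = 0\<close>\<close>
  have one: "measure M {\<omega> \<in> space M. Z n \<omega> = 1} = T.\<gamma> ^ n * a 0 n" for n
  proof -
    have "measure M {\<omega> \<in> space M. Z n \<omega> = 1} = measure M {\<omega> \<in> space M. Z n \<omega> = Suc 0 \<and> Z (n + 0) \<omega> = 1}"
      by (rule arg_cong[where f = "measure M"]) auto
    also have "\<dots> = T.\<gamma> ^ n * a 0 n * (real (Suc 0) * T.\<gamma> ^ 0 * b 0 0)"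
      by (rule two)
    also have "b 0 0 = 1" by (simp add: b_def T.seq\<nu>.P.prob_space)
    finally show ?thesis by simp
  qed
  have lim: "(\<lambda>n. \<P>(\<omega> in M. Z (nat \<lfloor>real n * t\<rfloor>) \<omega> = Suc j \<bar> Z n \<omega> = 1)) \<longlonglongrightarrow> pmf r (Suc j)"
    if t: "0 < t" "t < 1" for t :: real and j
  proof -
    let ?m = "\<lambda>n. nat \<lfloor>real n * t\<rfloor>"
    have eq: "\<P>(\<omega> in M. Z (?m n) \<omega> = Suc j \<bar> Z n \<omega> = 1) = a j (?m n) * (real (Suc j) * b j (n - ?m n)) / a 0 n" for n
    proof -
      have n: "n = ?m n + (n - ?m n)" using filterlim_time_fraction(3)[OF t, of n] by simp
      have "measure M {\<omega> \<in> space M. Z (?m n) \<omega> = Suc j \<and> Z n \<omega> = 1} =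
          T.\<gamma> ^ ?m n * a j (?m n) * (real (Suc j) * T.\<gamma> ^ (n - ?m n) * b j (n - ?m n))"
        using two[of "?m n" j "n - ?m n"] n by simp
      also have "\<dots> = T.\<gamma> ^ n * (a j (?m n) * (real (Suc j) * b j (n - ?m n)))"
        using power_add[of T.\<gamma> "?m n" "n - ?m n"] n by simp
      finally show ?thesis
        unfolding cond_prob_def one using T.\<gamma>_pos by simp
    qed
    have "(\<lambda>n. a j (?m n) * (real (Suc j) * b j (n - ?m n)) / a 0 n) \<longlonglongrightarrow>
        s * (real (Suc j) * (\<integral>\<pi>. (survival_prob \<pi>)\<^sup>2 * extinction_prob \<pi> ^ j \<partial>T.env\<^sub>\<nu>)) / s"
    proof (intro tendsto_divide tendsto_mult tendsto_const)
      show "(\<lambda>n. a j (?m n)) \<longlonglongrightarrow> s"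
        unfolding a_def s_def
        by (rule filterlim_compose[OF T.tilted_mass_from_one_limit filterlim_time_fraction(1)[OF t]])
      show "(\<lambda>n. b j (n - ?m n)) \<longlonglongrightarrow> (\<integral>\<pi>. (survival_prob \<pi>)\<^sup>2 * extinction_prob \<pi> ^ j \<partial>T.env\<^sub>\<nu>)"
        unfolding b_def
        by (rule filterlim_compose[OF T.tilted_mass_to_one_limit filterlim_time_fraction(2)[OF t]])
      show "a 0 \<longlonglongrightarrow> s"
        unfolding a_def s_def by (rule T.tilted_mass_from_one_limit)
      show "s \<noteq> 0" using T.survival_square_pos by (simp add: s_def)
    qed
    also have "s * (real (Suc j) * (\<integral>\<pi>. (survival_prob \<pi>)\<^sup>2 * extinction_prob \<pi> ^ j \<partial>T.env\<^sub>\<nu>)) / s = pmf r (Suc j)"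
      using T.survival_square_pos by (simp add: s_def r T.limit_mass_def)
    finally show ?thesis unfolding eq .
  qed
  show ?thesis
  proof (intro exI[of _ r] conjI allI impI)
    show "set_pmf r \<subseteq> {1..}"
    proof
      fix z assume "z \<in> set_pmf r"
      then have "z \<noteq> 0" using r[of 0] by (auto simp: set_pmf_iff T.limit_mass_def intro!: Nat.gr0I)
      then show "z \<in> {1..}" by simp
    qed
  next
    fix t :: real and z :: nat assume "0 < t" "t < 1" "1 \<le> z"
    then show "(\<lambda>n. \<P>(\<omega> in M. Z (nat \<lfloor>real n * t\<rfloor>) \<omega> = z \<bar> Z n \<omega> = 1)) \<longlonglongrightarrow> pmf r z"
      using lim[of t "z - 1"] by simp
  next
    fix z :: nat
    show "pmf r z = real z * (\<integral>\<pi>. (survival_prob \<pi>)\<^sup>2 * extinction_prob \<pi> ^ (z - 1)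
        \<partial>PiM UNIV (\<lambda>_. tilted_law (distr M distr_space (Q 0))))"
      unfolding r T.limit_mass_def unfolding \<mu>_def ..
  qed
qed

end
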